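(* Let $\mathbb{M}^2=(\mathbb{R}^2,\|\cdot\|)$ be a Minkowski plane. For $D\in[1/j(\mathbb{M}^2),2]$ let $r_D:=\min\{r(K):K\in\mathcal{K}^2,\ R(K)=1,\ D(K)=D\}$, and call the points $(r_D,D/2)$, $D\in[1/j(\mathbb{M}^2),2]$, left-most. A convex body $K\in\mathcal{K}^2$ (with $R(K)>0$) is said to be mapped to the point $\left(\frac{r(K)}{R(K)},\frac{D(K)}{2R(K)}\right)$. (i) If a body $K\in\mathcal{K}^2$ is mapped to a left-most point, then $K$ is a segment or a triangle. (ii) For each left-most point, there is a segment or an isosceles triangle mapped onto it.
   Context: $\mathcal{K}^2$ denotes the set of convex bodies in $\mathbb{R}^2$, i.e. non-empty, convex, compact sets (possibly with empty interior). A Minkowski plane is $\mathbb{R}^2$ with a norm $\|\cdot\|$; its unit ball is $\mathbb{B}=\{x:\|x\|\le 1\}$. For $K\in\mathcal{K}^2$: circumradius $R(K)=\inf\{\rho\ge 0:K\subset c+\rho\mathbb{B},\ c\in\mathbb{R}^2\}$; inradius $r(K)=\sup\{\rho\ge 0: c+\rho\mathbb{B}\subset K,\ c\in\mathbb{R}^2\}$; diameter $D(K)=\max_{x,y\in K}\|x-y\|$. The Jung constant is $j(\mathbb{M}^2)=\max\{R(K)/D(K):K\in\mathcal{K}^2,\ K\text{ not a single point}\}$. A triangle $T$ is called isosceles if at most one of its edges does not have diametrical length, i.e. at least two of its three edges have length (with respect to $\|\cdot\|$) equal to $D(T)$. *)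

theory Defs
  imports "HOL-Analysis.Analysis"
begin

text \<open>
  A Minkowski plane is the vector space \<open>real^2\<close> together with an arbitrary norm \<open>N\<close>, which is
  carried as an explicit argument. Compactness always refers to the standard topology of \<open>real^2\<close>;
  all norms on a finite-dimensional space induce that topology.
\<close>

definition is_norm :: "(real^2 \<Rightarrow> real) \<Rightarrow> bool" where
  "is_norm N \<longleftrightarrow>
     (\<forall>x. 0 \<le> N x) \<and>
     (\<forall>x. N x = 0 \<longleftrightarrow> x = 0) \<and>
     (\<forall>a x. N (a *\<^sub>R x) = \<bar>a\<bar> * N x) \<and>
     (\<forall>x y. N (x + y) \<le> N x + N y)"

definition unit_ball :: "(real^2 \<Rightarrow> real) \<Rightarrow> (real^2) set" where
  "unit_ball N = {x. N x \<le> 1}"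

definition homothetic_ball :: "(real^2 \<Rightarrow> real) \<Rightarrow> real^2 \<Rightarrow> real \<Rightarrow> (real^2) set" where
  "homothetic_ball N c \<rho> = (\<lambda>x. c + \<rho> *\<^sub>R x) ` unit_ball N"

definition convex_bodies :: "(real^2) set set" where
  "convex_bodies = {K. K \<noteq> {} \<and> convex K \<and> compact K}"

definition circumradius :: "(real^2 \<Rightarrow> real) \<Rightarrow> (real^2) set \<Rightarrow> real" where
  "circumradius N K = Inf {\<rho>. 0 \<le> \<rho> \<and> (\<exists>c. K \<subseteq> homothetic_ball N c \<rho>)}"

definition inradius :: "(real^2 \<Rightarrow> real) \<Rightarrow> (real^2) set \<Rightarrow> real" where
  "inradius N K = Sup {\<rho>. 0 \<le> \<rho> \<and> (\<exists>c. homothetic_ball N c \<rho> \<subseteq> K)}"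

text \<open>
  The library's \<open>diameter\<close> is tied to the Euclidean distance of \<open>real^2\<close>. The supremum below is a
  maximum when \<open>K\<close> is a convex body, by compactness.
\<close>

definition norm_diameter :: "(real^2 \<Rightarrow> real) \<Rightarrow> (real^2) set \<Rightarrow> real" where
  "norm_diameter N K = Sup {N (x - y) | x y. x \<in> K \<and> y \<in> K}"

text \<open>The supremum is attained (Blaschke selection), hence it is the maximum.\<close>

definition jung_constant :: "(real^2 \<Rightarrow> real) \<Rightarrow> real" where
  "jung_constant N =
     Sup {circumradius N K / norm_diameter N K | K. K \<in> convex_bodies \<and> \<not> (\<exists>x. K = {x})}"

text \<open>
  The minimum is written as an infimum. A body mapped onto \<open>(min_inradius N D, D / 2)\<close> can be
  rescaled to circumradius 1, so its existence says precisely that this infimum is attained.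
\<close>

definition min_inradius :: "(real^2 \<Rightarrow> real) \<Rightarrow> real \<Rightarrow> real" where
  "min_inradius N D =
     Inf {inradius N K | K. K \<in> convex_bodies \<and> circumradius N K = 1 \<and> norm_diameter N K = D}"

definition leftmost_points :: "(real^2 \<Rightarrow> real) \<Rightarrow> (real \<times> real) set" where
  "leftmost_points N = {(min_inradius N D, D / 2) | D. D \<in> {1 / jung_constant N .. 2}}"

definition mapped_to :: "(real^2 \<Rightarrow> real) \<Rightarrow> (real^2) set \<Rightarrow> real \<times> real \<Rightarrow> bool" where
  "mapped_to N K p \<longleftrightarrow>
     K \<in> convex_bodies \<and> circumradius N K > 0 \<and>
     p = (inradius N K / circumradius N K, norm_diameter N K / (2 * circumradius N K))"

definition is_segment :: "(real^2) set \<Rightarrow> bool" where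
  "is_segment K \<longleftrightarrow> (\<exists>a b. a \<noteq> b \<and> K = closed_segment a b)"

definition triangle_with_vertices ::
  "(real^2) set \<Rightarrow> real^2 \<Rightarrow> real^2 \<Rightarrow> real^2 \<Rightarrow> bool" where
  "triangle_with_vertices T a b c \<longleftrightarrow> \<not> collinear {a, b, c} \<and> T = convex hull {a, b, c}"

definition is_triangle :: "(real^2) set \<Rightarrow> bool" where
  "is_triangle T \<longleftrightarrow> (\<exists>a b c. triangle_with_vertices T a b c)"

text \<open>
  The equal edges of an isosceles triangle are required to be diametrical: two edges of equal
  length are not enough if the third one is longer.
\<close>

definition is_isosceles_triangle :: "(real^2 \<Rightarrow> real) \<Rightarrow> (real^2) set \<Rightarrow> bool" where
  "is_isosceles_triangle N T \<longleftrightarrow>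
     (\<exists>a b c. triangle_with_vertices T a b c \<and>
        (let D = norm_diameter N T in
           (N (a - b) = D \<and> N (b - c) = D) \<or>
           (N (b - c) = D \<and> N (c - a) = D) \<or>
           (N (c - a) = D \<and> N (a - b) = D)))"

end

(*
  If D = 2, the leftmost point is (0, 1): a segment is mapped to it, and a body without interior is a
  segment.  Let D < 2.  By Helly's theorem a body K of circumradius 1 and diameter D, placed in the
  unit ball B, contains three points of circumradius 1; since D < 2 they lie on the boundary of B and
  have 0 in their convex hull, and conversely every such triple has circumradius 1.  So the infimum is
  taken over these triangles, with edges at most D, and is attained by compactness.

  The inradius of a triangle is twice its area divided by its perimeter with respect to the norm
  v |-> max {det (v, y) | y in B}.  With two vertices fixed it is therefore a quasi-concave function of
  the third one.  Pushing the third vertex along the boundary of B in both directions until one of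
  its two edges has length D (the other one does not grow, by the monotonicity lemma), at least one
  of the two end positions does not increase the inradius.  Doing this for two vertices yields an
  isosceles minimiser.

  If a minimal K differs from the triangle of its critical triple, then K has a point strictly beyond
  exactly one edge.  The inball of the triangle contains no vertex because D < 2, so it can be moved
  across that edge into the interior of K and enlarged there, contradicting minimality.
*)

theory Submission
  imports Defs
begin

subsection \<open>Determinants and barycentric coordinates\<close>

text \<open>The bound \<open>d < 2\<close> matters because antipodal unit vectors have distance 2.
  With all edges shorter, 0 lies on no edge, so it is a strictly positive combination of the
  vertices, the triangle is nondegenerate, and its orientation is that of the pair
  \<open>p, q\<close> alone. The last point makes the area itself, not only the signed area, affine
  in the third vertex along the moves that are used.

  The norm need be neither smooth nor strictly convex, so neither unique normals nor unique contact
  points exist, and monotonicity along the sphere is only weak. Geometric steps are therefore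
  explicit linear identities followed by the triangle inequality; strictness is gained from the
  positive coefficients of 0 or from \<open>d < 2\<close>.

  Competitors for the minimum have diameter exactly \<open>D\<close>, but a vertex move preserves
  only upper bounds on edges. Nothing is lost by this relaxation, because the improved minimiser has
  an edge of length \<open>D\<close> and is itself a competitor.\<close>

definition det2 :: "real^2 \<Rightarrow> real^2 \<Rightarrow> real" where
  "det2 v w = v$1 * w$2 - v$2 * w$1"

lemma det2_simps:
  "det2 (a + b) c = det2 a c + det2 b c" "det2 c (a + b) = det2 c a + det2 c b"
  "det2 (a - b) c = det2 a c - det2 b c" "det2 c (a - b) = det2 c a - det2 c b"
  "det2 (t *\<^sub>R a) b = t * det2 a b" "det2 a (t *\<^sub>R b) = t * det2 a b"
  "det2 (- a) b = - det2 a b" "det2 a (- b) = - det2 a b"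
  "det2 0 a = 0" "det2 a 0 = 0" "det2 a a = 0"
  by (auto simp: det2_def algebra_simps)

lemma det2_commute: "det2 b a = - det2 a b"
  by (simp add: det2_def)

lemma det2_eq_0D:
  assumes "det2 a b = 0" "a \<noteq> 0"
  obtains t where "b = t *\<^sub>R a"
proof -
  have "a$1 \<noteq> 0 \<or> a$2 \<noteq> 0"
    using assms(2) by (auto simp: vec_eq_iff forall_2)
  then show thesis
  proof
    assume "a$1 \<noteq> 0"
    then have "b = (b$1 / a$1) *\<^sub>R a"
      using assms(1) by (auto simp: vec_eq_iff forall_2 det2_def field_simps)
    then show thesis using that by blast
  next
    assume "a$2 \<noteq> 0"
    then have "b = (b$2 / a$2) *\<^sub>R a"
      using assms(1) by (auto simp: vec_eq_iff forall_2 det2_def field_simps)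
    then show thesis using that by blast
  qed
qed

lemma continuous_on_det2 [continuous_intros]:
  assumes "continuous_on S f" "continuous_on S g"
  shows "continuous_on S (\<lambda>x. det2 (f x) (g x))"
  unfolding det2_def by (intro continuous_intros assms)

text \<open>The barycentric coordinate at the first vertex \<open>p\<close>, as a ratio of signed
  areas. The coordinates at \<open>q\<close> and \<open>s\<close> arise by rotating the arguments;
  by \<open>det2_cyclic\<close> all three share one denominator.\<close>

definition bary :: "real^2 \<Rightarrow> real^2 \<Rightarrow> real^2 \<Rightarrow> real^2 \<Rightarrow> real" where
  "bary p q s z = det2 (q - z) (s - z) / det2 (q - p) (s - p)"

lemma det2_cyclic:
  "det2 (s - q) (p - q) = det2 (q - p) (s - p)" "det2 (p - s) (q - s) = det2 (q - p) (s - p)"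
  by (auto simp: det2_def algebra_simps)

lemma bary_sum:
  assumes "det2 (q - p) (s - p) \<noteq> 0"
  shows "bary p q s z + bary q s p z + bary s p q z = 1"
  using assms unfolding bary_def det2_cyclic
  by (simp add: add_divide_distrib [symmetric]) (simp add: det2_def algebra_simps)

lemma bary_repr:
  assumes "det2 (q - p) (s - p) \<noteq> 0"
  shows "z = bary p q s z *\<^sub>R p + bary q s p z *\<^sub>R q + bary s p q z *\<^sub>R s"
proof -
  let ?d = "det2 (q - p) (s - p)"
  have "?d *\<^sub>R z = det2 (q - z) (s - z) *\<^sub>R p + det2 (s - z) (p - z) *\<^sub>R q + det2 (p - z) (q - z) *\<^sub>R s"
    by (auto simp: vec_eq_iff forall_2 det2_def algebra_simps)
  then have "(1 / ?d) *\<^sub>R (?d *\<^sub>R z) = (1 / ?d) *\<^sub>R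
      (det2 (q - z) (s - z) *\<^sub>R p + det2 (s - z) (p - z) *\<^sub>R q + det2 (p - z) (q - z) *\<^sub>R s)"
    by simp
  then show ?thesis
    using assms unfolding bary_def det2_cyclic by (simp add: scaleR_add_right)
qed

text \<open>The terms quadratic in the points cancel, and the slope involves only the opposite edge
  \<open>s - q\<close>. This is how \<open>dual_norm\<close> of that edge enters the tangency
  condition.\<close>

lemma bary_affine: "bary p q s (z + v) = bary p q s z + det2 (s - q) v / det2 (q - p) (s - p)"
  unfolding bary_def by (simp add: add_divide_distrib [symmetric]) (simp add: det2_def algebra_simps)

lemma bary_combination:
  assumes "det2 (q - p) (s - p) \<noteq> 0" "a + b + c = 1"
  shows "bary p q s (a *\<^sub>R p + b *\<^sub>R q + c *\<^sub>R s) = a"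
proof -
  have a: "a = 1 - b - c" using assms by simp
  show ?thesis
    unfolding bary_def using assms(1)
    by (simp add: divide_eq_eq a) (simp add: det2_def algebra_simps)
qed

lemma continuous_on_bary [continuous_intros]:
  assumes "continuous_on S f"
  shows "continuous_on S (\<lambda>x. bary p q s (f x))"
  unfolding bary_def divide_inverse by (intro continuous_intros assms)

lemma mem_triangle_iff:
  assumes "det2 (q - p) (s - p) \<noteq> 0"
  shows "z \<in> convex hull {p, q, s} \<longleftrightarrow> 0 \<le> bary p q s z \<and> 0 \<le> bary q s p z \<and> 0 \<le> bary s p q z"
proof
  assume "z \<in> convex hull {p, q, s}"
  then obtain a b c where abc: "0 \<le> a" "0 \<le> b" "0 \<le> c" "a + b + c = 1"
    and z: "z = a *\<^sub>R p + b *\<^sub>R q + c *\<^sub>R s"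
    unfolding convex_hull_3 by auto
  have "bary p q s z = a" using assms abc z bary_combination by simp
  moreover have "bary q s p z = b"
    using bary_combination [of s q p b c a] assms abc z by (simp add: det2_cyclic ac_simps)
  moreover have "bary s p q z = c"
    using bary_combination [of p s q c a b] assms abc z by (simp add: det2_cyclic ac_simps)
  ultimately show "0 \<le> bary p q s z \<and> 0 \<le> bary q s p z \<and> 0 \<le> bary s p q z"
    using abc by simp
next
  assume "0 \<le> bary p q s z \<and> 0 \<le> bary q s p z \<and> 0 \<le> bary s p q z"
  then show "z \<in> convex hull {p, q, s}"
    unfolding convex_hull_3 using bary_repr [OF assms, of z] bary_sum [OF assms, of z] by blast
qed

lemma collinear_3_det2:
  assumes "collinear {p, q, s}"
  shows "det2 (q - p) (s - p) = 0"
proof -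
  from assms obtain u where u: "\<And>x y. x \<in> {p,q,s} \<Longrightarrow> y \<in> {p,q,s} \<Longrightarrow> \<exists>c. x - y = c *\<^sub>R u"
    unfolding collinear_def by blast
  obtain a b where "q - p = a *\<^sub>R u" "s - p = b *\<^sub>R u"
    using u [of q p] u [of s p] by auto
  then show ?thesis by (simp add: det2_simps)
qed

subsection \<open>Radii and diameter in a normed plane\<close>

locale normed_plane =
  fixes N :: "real^2 \<Rightarrow> real"
  assumes norm: "is_norm N"
begin

lemma N_nonneg [simp]: "0 \<le> N x"
  and N_eq_0 [simp]: "N x = 0 \<longleftrightarrow> x = 0"
  and N_scale: "N (a *\<^sub>R x) = \<bar>a\<bar> * N x"
  and N_triangle: "N (x + y) \<le> N x + N y"
  using norm unfolding is_norm_def by auto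

lemma N_zero [simp]: "N 0 = 0"
  by simp

lemma N_minus [simp]: "N (- x) = N x"
  using N_scale [of "-1" x] by simp

lemma N_commute: "N (x - y) = N (y - x)"
  using N_minus [of "x - y"] by simp

lemma N_triangle_diff: "N (x - y) \<le> N x + N y"
  using N_triangle [of x "- y"] by simp

lemma N_triangle_mid: "N (x - z) \<le> N (x - y) + N (y - z)"
  using N_triangle [of "x - y" "y - z"] by simp

lemma N_ge_diff: "N x - N y \<le> N (x - y)"
  using N_triangle [of "x - y" y] by simp

lemma N_combination2: "N (a *\<^sub>R x + b *\<^sub>R y) \<le> \<bar>a\<bar> * N x + \<bar>b\<bar> * N y"
  using N_triangle [of "a *\<^sub>R x" "b *\<^sub>R y"] by (simp add: N_scale)

lemma N_le_norm: obtains C where "0 < C" "\<And>x. N x \<le> C * norm x"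
proof
  let ?C = "N (axis 1 1) + N (axis 2 1) + 1"
  show "0 < ?C" using N_nonneg [of "axis 1 1"] N_nonneg [of "axis 2 1"] by linarith
  fix x :: "real^2"
  have x: "x = x$1 *\<^sub>R axis 1 1 + x$2 *\<^sub>R axis 2 1"
    by (auto simp: vec_eq_iff forall_2 axis_def)
  have "N x \<le> \<bar>x$1\<bar> * N (axis 1 1) + \<bar>x$2\<bar> * N (axis 2 1)"
    using N_combination2 [of "x$1" "axis 1 1" "x$2" "axis 2 1"] x by simp
  also have "\<dots> \<le> norm x * N (axis 1 1) + norm x * N (axis 2 1)"
    by (intro add_mono mult_right_mono component_le_norm_cart) auto
  also have "\<dots> \<le> ?C * norm x" by (simp add: algebra_simps)
  finally show "N x \<le> ?C * norm x" .
qed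

lemma continuous_N: "continuous_on UNIV N"
proof -
  obtain C where C: "0 < C" "\<And>x. N x \<le> C * norm x" by (rule N_le_norm) blast
  have "dist (N x) (N y) \<le> C * dist x y" for x y
    using N_ge_diff [of x y] N_ge_diff [of y x] N_commute [of x y] C(2) [of "x - y"]
    by (simp add: dist_norm abs_le_iff)
  then have "C-lipschitz_on UNIV N"
    using C by (auto intro!: lipschitz_onI)
  then show ?thesis by (rule lipschitz_on_continuous_on)
qed

lemma continuous_on_N [continuous_intros]:
  assumes "continuous_on S f"
  shows "continuous_on S (\<lambda>x. N (f x))"
  using continuous_on_compose2 [OF continuous_N assms] by simp

text \<open>The minimum of \<open>N\<close> over the Euclidean unit sphere is positive. With
  \<open>N_le_norm\<close> this gives equivalence to the Euclidean norm, to which compactness and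
  openness refer.\<close>

lemma norm_le_N: obtains m where "0 < m" "\<And>x. m * norm x \<le> N x"
proof -
  have "\<exists>x\<in>sphere 0 1. \<forall>y\<in>sphere 0 1. N x \<le> N y"
    by (rule continuous_attains_inf) (auto intro: continuous_on_N continuous_on_id)
  then obtain u where u: "norm u = 1" "\<And>y. norm y = 1 \<Longrightarrow> N u \<le> N y"
    by (auto simp: dist_norm)
  show thesis
  proof
    have "u \<noteq> 0" using u(1) by auto
    then show "0 < N u" using N_nonneg [of u] by (simp add: less_le)
    fix x :: "real^2"
    show "N u * norm x \<le> N x"
    proof (cases "x = 0")
      case False
      then have "N u \<le> N ((1 / norm x) *\<^sub>R x)" by (intro u) simp
      with False show ?thesis by (simp add: N_scale field_simps)
    qed simp
  qed
qed

text \<open>A membership condition in place of the image \<open>homothetic_ball\<close>. The two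
  agree for nonnegative radii; for a negative radius this set is empty while the image is a genuine
  ball.\<close>

definition nball :: "real^2 \<Rightarrow> real \<Rightarrow> (real^2) set" where
  "nball c \<rho> = {x. N (x - c) \<le> \<rho>}"

lemma homothetic_ball_eq:
  assumes "0 \<le> \<rho>"
  shows "homothetic_ball N c \<rho> = nball c \<rho>"
proof
  show "homothetic_ball N c \<rho> \<subseteq> nball c \<rho>"
    using assms by (auto simp: homothetic_ball_def unit_ball_def nball_def N_scale mult_left_le)
  show "nball c \<rho> \<subseteq> homothetic_ball N c \<rho>"
  proof
    fix x assume x: "x \<in> nball c \<rho>"
    show "x \<in> homothetic_ball N c \<rho>"
    proof (cases "\<rho> = 0")
      case True
      have "N (x - c) = 0" using x True N_nonneg [of "x - c"] by (simp add: nball_def)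
      then have "x = c + \<rho> *\<^sub>R 0" by simp
      then show ?thesis
        unfolding homothetic_ball_def unit_ball_def by (intro image_eqI [where x = 0]) auto
    next
      case False
      then have "x = c + \<rho> *\<^sub>R ((1 / \<rho>) *\<^sub>R (x - c))" by simp
      moreover have "N ((1 / \<rho>) *\<^sub>R (x - c)) \<le> 1"
        using x False assms by (simp add: N_scale nball_def)
      ultimately show ?thesis unfolding homothetic_ball_def unit_ball_def by blast
    qed
  qed
qed

lemma convex_nball: "convex (nball c \<rho>)"
proof (rule convexI)
  fix x y and u v :: real
  assume A: "x \<in> nball c \<rho>" "y \<in> nball c \<rho>" "0 \<le> u" "0 \<le> v" "u + v = 1"
  have "u *\<^sub>R x + v *\<^sub>R y - c = u *\<^sub>R x + v *\<^sub>R y - (u + v) *\<^sub>R c"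
    using A by simp
  also have "\<dots> = u *\<^sub>R (x - c) + v *\<^sub>R (y - c)"
    by (simp add: algebra_simps)
  finally have "N (u *\<^sub>R x + v *\<^sub>R y - c) \<le> u * N (x - c) + v * N (y - c)"
    using N_combination2 [of u "x - c" v "y - c"] A by simp
  also have "\<dots> \<le> u * \<rho> + v * \<rho>"
    using A by (intro add_mono mult_left_mono) (auto simp: nball_def)
  finally show "u *\<^sub>R x + v *\<^sub>R y \<in> nball c \<rho>"
    using A by (simp add: nball_def flip: distrib_right)
qed

lemma compact_nball: "compact (nball c \<rho>)"
proof -
  obtain m where m: "0 < m" "\<And>x. m * norm x \<le> N x" by (rule norm_le_N) blast
  have "closed (nball c \<rho>)"
    unfolding nball_def by (intro closed_Collect_le continuous_intros)
  moreover have "nball c \<rho> \<subseteq> cball c (\<rho> / m)"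
  proof
    fix x assume "x \<in> nball c \<rho>"
    then have "m * norm (x - c) \<le> \<rho>" using m(2) [of "x - c"] by (simp add: nball_def)
    then show "x \<in> cball c (\<rho> / m)"
      using m(1) by (simp add: dist_norm norm_minus_commute field_simps)
  qed
  then have "bounded (nball c \<rho>)" using bounded_cball bounded_subset by blast
  ultimately show ?thesis by (simp add: compact_eq_bounded_closed)
qed

lemma N_unit_exists: obtains u where "N u = 1"
proof
  have "axis 1 1 \<noteq> (0 :: real^2)" by (simp add: axis_eq_0_iff)
  then have "N (axis 1 1) \<noteq> 0" by simp
  then show "N ((1 / N (axis 1 1)) *\<^sub>R axis 1 1) = 1" by (simp add: N_scale)
qed

section \<open>The norm dual to \<open>N\<close>, evaluated on edge vectors\<close>

text \<open>\<open>det2 v\<close> is the scalar product with \<open>v\<close> turned by a right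
  angle, so this is the support function of the unit ball in the direction normal to
  \<open>v\<close>. Edges can be measured without naming normals.\<close>

definition dual_norm :: "real^2 \<Rightarrow> real" where
  "dual_norm v = (SUP y\<in>nball 0 1. det2 v y)"

lemma bdd_above_det2: "bdd_above (det2 v ` nball 0 1)"
  by (intro bounded_imp_bdd_above compact_imp_bounded compact_continuous_image
      continuous_intros compact_nball)

lemma det2_le_dual_norm: "N y \<le> 1 \<Longrightarrow> det2 v y \<le> dual_norm v"
  unfolding dual_norm_def by (intro cSUP_upper bdd_above_det2) (simp add: nball_def)

lemma dual_norm_le: "(\<And>y. N y \<le> 1 \<Longrightarrow> det2 v y \<le> b) \<Longrightarrow> dual_norm v \<le> b"
  unfolding dual_norm_def by (intro cSUP_least) (auto simp: nball_def intro: exI [of _ 0])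

lemma dual_norm_nonneg: "0 \<le> dual_norm v"
  using det2_le_dual_norm [of 0 v] by (simp add: det2_simps)

lemma dual_norm_scale_le: "dual_norm (a *\<^sub>R v) \<le> \<bar>a\<bar> * dual_norm v"
proof (rule dual_norm_le)
  fix y assume y: "N y \<le> 1"
  have "det2 v y \<le> dual_norm v" "- det2 v y \<le> dual_norm v"
    using det2_le_dual_norm [OF y, of v] det2_le_dual_norm [of "- y" v] y by (auto simp: det2_simps)
  then have "\<bar>det2 v y\<bar> \<le> dual_norm v" by linarith
  then have "\<bar>a\<bar> * \<bar>det2 v y\<bar> \<le> \<bar>a\<bar> * dual_norm v" by (intro mult_left_mono) auto
  moreover have "a * det2 v y \<le> \<bar>a\<bar> * \<bar>det2 v y\<bar>" by (metis abs_ge_self abs_mult)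
  ultimately show "det2 (a *\<^sub>R v) y \<le> \<bar>a\<bar> * dual_norm v" by (simp add: det2_simps)
qed

text \<open>Lets the locale be interpreted at \<open>dual_norm\<close>, so that convexity and
  continuity of the perimeter follow from the facts already proved for \<open>N\<close>.\<close>

lemma is_norm_dual_norm: "is_norm dual_norm"
  unfolding is_norm_def
proof (intro conjI allI)
  show "0 \<le> dual_norm v" for v by (rule dual_norm_nonneg)
  show "dual_norm (v + w) \<le> dual_norm v + dual_norm w" for v w
    by (rule dual_norm_le) (auto simp: det2_simps intro: add_mono det2_le_dual_norm)
  show "dual_norm v = 0 \<longleftrightarrow> v = 0" for v
  proof
    assume v0: "dual_norm v = 0"
    show "v = 0"
    proof (rule ccontr)
      assume "v \<noteq> 0"
      \<comment> \<open>A quarter turn of \<open>v\<close>, chosen so that \<open>det2 v w\<close>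
        is the squared Euclidean length of \<open>v\<close>.\<close>
      define w :: "real^2" where "w = vector [- v$2, v$1]"
      have d: "det2 v w = (v$1)\<^sup>2 + (v$2)\<^sup>2" by (simp add: det2_def w_def power2_eq_square)
      have "v$1 \<noteq> 0 \<or> v$2 \<noteq> 0" using \<open>v \<noteq> 0\<close> by (auto simp: vec_eq_iff forall_2)
      then have d0: "0 < det2 v w" unfolding d by (simp add: sum_power2_gt_zero_iff)
      then have "w \<noteq> 0" by (auto simp: det2_simps)
      then have w: "0 < N w" using N_eq_0 [of w] N_nonneg [of w] by linarith
      have "det2 v ((1 / N w) *\<^sub>R w) \<le> dual_norm v"
        using w by (intro det2_le_dual_norm) (simp add: N_scale)
      then have "det2 v w \<le> 0" using w v0 by (simp add: det2_simps divide_le_eq)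
      then show False using d0 by simp
    qed
  next
    assume "v = 0"
    then show "dual_norm v = 0" using dual_norm_le [of v 0] dual_norm_nonneg [of v] by (simp add: det2_simps)
  qed
  show "dual_norm (a *\<^sub>R v) = \<bar>a\<bar> * dual_norm v" for a v
  proof (cases "a = 0")
    case True
    then show ?thesis using dual_norm_scale_le [of 0 v] dual_norm_nonneg [of 0] by simp
  next
    case False
    then have "dual_norm v \<le> \<bar>1 / a\<bar> * dual_norm (a *\<^sub>R v)" using dual_norm_scale_le [of "1 / a" "a *\<^sub>R v"] by simp
    then have "\<bar>a\<bar> * dual_norm v \<le> dual_norm (a *\<^sub>R v)" using False by (simp add: field_simps)
    then show ?thesis using dual_norm_scale_le [of a v] by linarith
  qed
qed

lemma normed_plane_dual_norm: "normed_plane dual_norm"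
  by (rule normed_plane.intro is_norm_dual_norm)+

section \<open>Attainment and basic bounds for diameter, circumradius and inradius\<close>

lemma N_le_norm_diameter:
  assumes "compact K" "x \<in> K" "y \<in> K"
  shows "N (x - y) \<le> norm_diameter N K"
proof -
  have "compact ((\<lambda>z. N (fst z - snd z)) ` (K \<times> K))"
    by (intro compact_continuous_image continuous_intros compact_Times assms(1))
  then have "bdd_above ((\<lambda>z. N (fst z - snd z)) ` (K \<times> K))"
    by (intro bounded_imp_bdd_above compact_imp_bounded)
  then obtain b where b: "\<And>z. z \<in> K \<times> K \<Longrightarrow> N (fst z - snd z) \<le> b"
    unfolding bdd_above_def by blast
  have "bdd_above {N (x - y) | x y. x \<in> K \<and> y \<in> K}"
  proof (rule bdd_aboveI)
    fix v assume "v \<in> {N (x - y) | x y. x \<in> K \<and> y \<in> K}"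
    then obtain x y where "x \<in> K" "y \<in> K" "v = N (x - y)" by blast
    then show "v \<le> b" using b [of "(x, y)"] by simp
  qed
  then show ?thesis unfolding norm_diameter_def by (intro cSup_upper) (use assms in blast)
qed

lemma norm_diameter_le:
  assumes "K \<noteq> {}" "\<And>x y. x \<in> K \<Longrightarrow> y \<in> K \<Longrightarrow> N (x - y) \<le> d"
  shows "norm_diameter N K \<le> d"
  unfolding norm_diameter_def
proof (rule cSup_least)
  show "{N (x - y) | x y. x \<in> K \<and> y \<in> K} \<noteq> {}" using assms(1) by blast
qed (use assms(2) in blast)

text \<open>Balls are convex, so a bound on distances from a fixed point passes from
  \<open>S\<close> to its hull. This is applied once for each of the two arguments.\<close>

lemma norm_diameter_hull_le:
  assumes "S \<noteq> {}" "\<And>x y. x \<in> S \<Longrightarrow> y \<in> S \<Longrightarrow> N (x - y) \<le> d"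
  shows "norm_diameter N (convex hull S) \<le> d"
proof (rule norm_diameter_le)
  show "convex hull S \<noteq> {}" using assms by simp
  fix x y assume xy: "x \<in> convex hull S" "y \<in> convex hull S"
  have *: "convex hull S \<subseteq> nball z d" if "\<And>w. w \<in> S \<Longrightarrow> N (w - z) \<le> d" for z
    using that by (intro hull_minimal convex_nball) (auto simp: nball_def)
  have "N (z - y) \<le> d" if "z \<in> S" for z
    using * [of z] xy assms(2) that N_commute [of z y] by (auto simp: nball_def)
  then show "N (x - y) \<le> d"
    using * [of y] xy by (auto simp: nball_def)
qed

lemma circumradius_eq: "circumradius N K = Inf {\<rho>. 0 \<le> \<rho> \<and> (\<exists>c. K \<subseteq> nball c \<rho>)}"
  unfolding circumradius_def by (simp add: homothetic_ball_eq cong: conj_cong)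

lemma inradius_eq: "inradius N K = Sup {\<rho>. 0 \<le> \<rho> \<and> (\<exists>c. nball c \<rho> \<subseteq> K)}"
  unfolding inradius_def by (simp add: homothetic_ball_eq cong: conj_cong)

lemma circumradius_le: "0 \<le> \<rho> \<Longrightarrow> K \<subseteq> nball c \<rho> \<Longrightarrow> circumradius N K \<le> \<rho>"
  unfolding circumradius_eq by (rule cInf_lower) (auto intro: bdd_belowI [of _ 0])

lemma subset_nball_norm_diameter:
  assumes "compact K" "x \<in> K"
  shows "K \<subseteq> nball x (norm_diameter N K)"
  using N_le_norm_diameter [OF assms(1) _ assms(2)] by (auto simp: nball_def)

lemma norm_diameter_nonneg: "compact K \<Longrightarrow> x \<in> K \<Longrightarrow> 0 \<le> norm_diameter N K"
  using N_le_norm_diameter [of K x x] by simp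

lemma circumradius_ge:
  assumes "compact K" "K \<noteq> {}" "\<And>c r. 0 \<le> r \<Longrightarrow> K \<subseteq> nball c r \<Longrightarrow> \<rho> \<le> r"
  shows "\<rho> \<le> circumradius N K"
  unfolding circumradius_eq
proof (rule cInf_greatest)
  obtain x where "x \<in> K" using assms(2) by blast
  then show "{\<rho>. 0 \<le> \<rho> \<and> (\<exists>c. K \<subseteq> nball c \<rho>)} \<noteq> {}"
    using subset_nball_norm_diameter norm_diameter_nonneg assms(1) by blast
qed (use assms(3) in blast)

lemma circumradius_nonneg: "compact K \<Longrightarrow> K \<noteq> {} \<Longrightarrow> 0 \<le> circumradius N K"
  by (rule circumradius_ge)

lemma norm_diameter_le_circumradius:
  assumes "compact K" "K \<noteq> {}"
  shows "norm_diameter N K \<le> 2 * circumradius N K"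
proof -
  have "norm_diameter N K / 2 \<le> circumradius N K"
  proof (rule circumradius_ge [OF assms])
    fix c r assume "K \<subseteq> nball c r"
    then have r: "N (x - c) \<le> r" if "x \<in> K" for x using that by (auto simp: nball_def)
    have "N (x - y) \<le> r + r" if "x \<in> K" "y \<in> K" for x y
      using r [OF that(1)] r [OF that(2)] N_triangle_mid [of x y c] N_commute [of c y] by linarith
    then have "norm_diameter N K \<le> r + r" by (rule norm_diameter_le [OF assms(2)])
    then show "norm_diameter N K / 2 \<le> r" by simp
  qed
  then show ?thesis by simp
qed

text \<open>Centres that work for a radius \<open>1 / (n + 1)\<close> above the circumradius form
  nested nonempty compact sets; a centre common to all of them works for the circumradius
  itself.\<close>

lemma circumball_exists:
  assumes "compact K" "K \<noteq> {}"
  obtains c where "K \<subseteq> nball c (circumradius N K)"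
proof -
  let ?R = "circumradius N K"
  define F where "F n = {c. \<forall>x\<in>K. N (x - c) \<le> ?R + 1 / Suc n}" for n :: nat
  have F: "F n = (\<Inter>x\<in>K. nball x (?R + 1 / Suc n))" for n
    by (auto simp: F_def nball_def N_commute)
  obtain x0 where "x0 \<in> K" using assms by blast
  have "\<Inter> (range F) \<noteq> {}"
  proof (rule compact_nest)
    show "compact (F n)" for n
    proof -
      have "closed (F n)" unfolding F by (intro closed_INT ballI compact_imp_closed compact_nball)
      then have "compact (nball x0 (?R + 1 / Suc n) \<inter> F n)"
        by (intro compact_Int_closed compact_nball)
      moreover have "nball x0 (?R + 1 / Suc n) \<inter> F n = F n"
        unfolding F using \<open>x0 \<in> K\<close> by blast
      ultimately show ?thesis by simp
    qed
    show "F n \<subseteq> F m" if "m \<le> n" for m n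
    proof -
      have "1 / real (Suc n) \<le> 1 / real (Suc m)" using that by (simp add: frac_le)
      then show ?thesis unfolding F_def by fastforce
    qed
    show "F n \<noteq> {}" for n
    proof -
      obtain \<rho> where "\<rho> \<in> {\<rho>. 0 \<le> \<rho> \<and> (\<exists>c. K \<subseteq> nball c \<rho>)}" "\<rho> < ?R + 1 / Suc n"
      proof (rule cInf_lessD [of "{\<rho>. 0 \<le> \<rho> \<and> (\<exists>c. K \<subseteq> nball c \<rho>)}" "?R + 1 / Suc n", THEN bexE])
        show "{\<rho>. 0 \<le> \<rho> \<and> (\<exists>c. K \<subseteq> nball c \<rho>)} \<noteq> {}"
          using subset_nball_norm_diameter norm_diameter_nonneg assms(1) \<open>x0 \<in> K\<close> by blast
        show "Inf {\<rho>. 0 \<le> \<rho> \<and> (\<exists>c. K \<subseteq> nball c \<rho>)} < ?R + 1 / Suc n"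
          unfolding circumradius_eq [symmetric] by simp
      qed
      then obtain c where "K \<subseteq> nball c \<rho>" by blast
      have "N (x - c) \<le> ?R + 1 / Suc n" if "x \<in> K" for x
      proof -
        have "x \<in> nball c \<rho>" using \<open>K \<subseteq> nball c \<rho>\<close> that by blast
        then show ?thesis using \<open>\<rho> < ?R + 1 / Suc n\<close> by (simp add: nball_def)
      qed
      then show ?thesis unfolding F_def by blast
    qed
  qed
  then obtain c where c: "\<And>n. c \<in> F n" by blast
  have "N (x - c) \<le> ?R" if "x \<in> K" for x
  proof (rule field_le_epsilon)
    fix e :: real assume "0 < e"
    then obtain n where "1 / real (Suc n) < e" by (metis nat_approx_posE)
    moreover have "N (x - c) \<le> ?R + 1 / Suc n" using c [of n] that by (simp add: F_def)
    ultimately show "N (x - c) \<le> ?R + e" by linarith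
  qed
  then show thesis using that by (auto simp: nball_def)
qed

lemma nball_subset_norm_diameter:
  assumes "compact K" "nball c \<rho> \<subseteq> K" "0 \<le> \<rho>"
  shows "2 * \<rho> \<le> norm_diameter N K"
proof -
  obtain u where u: "N u = 1" by (rule N_unit_exists)
  have "c + \<rho> *\<^sub>R u \<in> K" "c - \<rho> *\<^sub>R u \<in> K"
    using assms u by (auto simp: nball_def N_scale intro!: subsetD [OF assms(2)])
  from N_le_norm_diameter [OF assms(1) this]
  have "N (c + \<rho> *\<^sub>R u - (c - \<rho> *\<^sub>R u)) \<le> norm_diameter N K" .
  also have "c + \<rho> *\<^sub>R u - (c - \<rho> *\<^sub>R u) = (2 * \<rho>) *\<^sub>R u"
    by (simp add: vec_eq_iff)
  finally have "N ((2 * \<rho>) *\<^sub>R u) \<le> norm_diameter N K" .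
  then show ?thesis using u assms(3) by (simp add: N_scale)
qed

lemma inradius_ge:
  assumes "compact K" "nball c \<rho> \<subseteq> K" "0 \<le> \<rho>"
  shows "\<rho> \<le> inradius N K"
  unfolding inradius_eq
proof (rule cSup_upper)
  show "bdd_above {\<rho>. 0 \<le> \<rho> \<and> (\<exists>c. nball c \<rho> \<subseteq> K)}"
    using nball_subset_norm_diameter [OF assms(1)]
    by (intro bdd_aboveI [of _ "norm_diameter N K / 2"]) force
qed (use assms in blast)

lemma nball_zero [simp]: "nball c 0 = {c}"
  by (auto simp: nball_def) (metis N_eq_0 N_nonneg antisym eq_iff_diff_eq_0)

lemma inradius_le:
  assumes "K \<noteq> {}" "\<And>c r. 0 \<le> r \<Longrightarrow> nball c r \<subseteq> K \<Longrightarrow> r \<le> \<rho>"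
  shows "inradius N K \<le> \<rho>"
  unfolding inradius_eq
proof (rule cSup_least)
  obtain x where "x \<in> K" using assms(1) by blast
  then have "nball x 0 \<subseteq> K" by simp
  then show "{\<rho>. 0 \<le> \<rho> \<and> (\<exists>c. nball c \<rho> \<subseteq> K)} \<noteq> {}" by blast
qed (use assms(2) in blast)

lemma inradius_nonneg: "compact K \<Longrightarrow> K \<noteq> {} \<Longrightarrow> 0 \<le> inradius N K"
  using inradius_ge [of K _ 0] by auto

lemma inradius_mono:
  assumes "K \<noteq> {}" "K \<subseteq> L" "compact L"
  shows "inradius N K \<le> inradius N L"
proof (rule inradius_le [OF assms(1)])
  fix c r assume "0 \<le> r" "nball c r \<subseteq> K"
  then show "r \<le> inradius N L" using inradius_ge [OF assms(3), of c r] assms(2) by blast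
qed

section \<open>The inball of a triangle\<close>

definition triangle_inradius :: "real^2 \<Rightarrow> real^2 \<Rightarrow> real^2 \<Rightarrow> real" where
  "triangle_inradius p q s = \<bar>det2 (q - p) (s - p)\<bar> / (dual_norm (q - p) + dual_norm (s - q) + dual_norm (p - s))"

text \<open>The support number of the unit ball orthogonal to an edge is \<open>dual_norm\<close> of that edge, and the edge
  vectors sum to zero; adding up the three tangency conditions gives
  \<open>2 area = inradius * perimeter\<close> with the perimeter measured by \<open>dual_norm\<close>.\<close>
lemma nball_subset_halfplane_iff:
  assumes d: "det2 (q - p) (s - p) \<noteq> 0" and r: "0 \<le> r"
  shows "(\<forall>z\<in>nball c r. 0 \<le> bary p q s z) \<longleftrightarrow>
    r * dual_norm (s - q) \<le> bary p q s c * \<bar>det2 (q - p) (s - p)\<bar>"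
proof -
  let ?d = "det2 (q - p) (s - p)"
  have r_iff: "(\<forall>z\<in>nball c r. 0 \<le> bary p q s z) \<longleftrightarrow> (\<forall>y. N y \<le> 1 \<longrightarrow> 0 \<le> bary p q s (c + r *\<^sub>R y))"
  proof (cases "r = 0")
    case True
    have "N 0 \<le> 1" by simp
    then show ?thesis unfolding True by (metis add.right_neutral nball_zero scaleR_zero_left singleton_iff)
  next
    case False
    show ?thesis
      unfolding homothetic_ball_eq [OF r, symmetric] homothetic_ball_def unit_ball_def by auto
  qed
  have "0 \<le> bary p q s (c + r *\<^sub>R y) \<longleftrightarrow> r * (- sgn ?d * det2 (s - q) y) \<le> bary p q s c * \<bar>?d\<bar>" for y
    unfolding bary_affine using d by (cases "0 < ?d") (auto simp: det2_simps(6) field_simps)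
  then have "(\<forall>z\<in>nball c r. 0 \<le> bary p q s z) \<longleftrightarrow>
     (\<forall>y. N y \<le> 1 \<longrightarrow> r * (- sgn ?d * det2 (s - q) y) \<le> bary p q s c * \<bar>?d\<bar>)"
    unfolding r_iff by simp
  \<comment> \<open>The unit ball is symmetric, so the orientation sign can be absorbed into
    \<open>y\<close>.\<close>
  also have "\<dots> \<longleftrightarrow> (\<forall>y. N y \<le> 1 \<longrightarrow> r * det2 (s - q) y \<le> bary p q s c * \<bar>?d\<bar>)"
  proof (cases "0 < ?d")
    case True
    have *: "N y \<le> 1 \<longleftrightarrow> N (- y) \<le> 1" for y by simp
    have "(\<forall>y. N y \<le> 1 \<longrightarrow> r * (- sgn ?d * det2 (s - q) y) \<le> bary p q s c * \<bar>?d\<bar>) \<longleftrightarrow>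
      (\<forall>y. N (- y) \<le> 1 \<longrightarrow> r * det2 (s - q) (- y) \<le> bary p q s c * \<bar>?d\<bar>)"
      using True by (simp add: det2_simps(8))
    also have "\<dots> \<longleftrightarrow> (\<forall>y. N y \<le> 1 \<longrightarrow> r * det2 (s - q) y \<le> bary p q s c * \<bar>?d\<bar>)"
      by (metis minus_minus)
    finally show ?thesis .
  next
    case False
    then show ?thesis using d by simp
  qed
  also have "\<dots> \<longleftrightarrow> r * dual_norm (s - q) \<le> bary p q s c * \<bar>?d\<bar>"
  proof
    assume A: "\<forall>y. N y \<le> 1 \<longrightarrow> r * det2 (s - q) y \<le> bary p q s c * \<bar>?d\<bar>"
    show "r * dual_norm (s - q) \<le> bary p q s c * \<bar>?d\<bar>"
    proof (cases "r = 0")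
      case True
      then show ?thesis using A [rule_format, of 0] by simp
    next
      case False
      then have "dual_norm (s - q) \<le> bary p q s c * \<bar>?d\<bar> / r"
        using A r by (intro dual_norm_le) (simp add: field_simps)
      then show ?thesis using False r by (simp add: field_simps)
    qed
  next
    assume A: "r * dual_norm (s - q) \<le> bary p q s c * \<bar>?d\<bar>"
    show "\<forall>y. N y \<le> 1 \<longrightarrow> r * det2 (s - q) y \<le> bary p q s c * \<bar>?d\<bar>"
      using det2_le_dual_norm [of _ "s - q"] A r by (meson mult_left_mono order_trans)
  qed
  finally show ?thesis .
qed

lemma nball_subset_triangle_iff:
  assumes "det2 (q - p) (s - p) \<noteq> 0" "0 \<le> r"
  shows "nball c r \<subseteq> convex hull {p, q, s} \<longleftrightarrow>
    r * dual_norm (s - q) \<le> bary p q s c * \<bar>det2 (q - p) (s - p)\<bar> \<and>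
    r * dual_norm (p - s) \<le> bary q s p c * \<bar>det2 (q - p) (s - p)\<bar> \<and>
    r * dual_norm (q - p) \<le> bary s p q c * \<bar>det2 (q - p) (s - p)\<bar>"
proof -
  have "nball c r \<subseteq> convex hull {p, q, s} \<longleftrightarrow> (\<forall>z\<in>nball c r. 0 \<le> bary p q s z) \<and>
    (\<forall>z\<in>nball c r. 0 \<le> bary q s p z) \<and> (\<forall>z\<in>nball c r. 0 \<le> bary s p q z)"
    using mem_triangle_iff [OF assms(1)] by blast
  then show ?thesis
    using nball_subset_halfplane_iff [of q p s r c] nball_subset_halfplane_iff [of s q p r c]
      nball_subset_halfplane_iff [of p s q r c] assms
    by (simp add: det2_cyclic)
qed

lemma dual_norm_perimeter_pos:
  assumes "det2 (q - p) (s - p) \<noteq> 0"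
  shows "0 < dual_norm (q - p) + dual_norm (s - q) + dual_norm (p - s)"
proof -
  have "q - p \<noteq> 0" using assms by (auto simp: det2_simps)
  then have "dual_norm (q - p) \<noteq> 0" using is_norm_dual_norm unfolding is_norm_def by blast
  then show ?thesis using dual_norm_nonneg [of "q - p"] dual_norm_nonneg [of "s - q"] dual_norm_nonneg [of "p - s"] by linarith
qed

lemma inball_triangle:
  assumes d: "det2 (q - p) (s - p) \<noteq> 0"
  obtains c where "nball c (triangle_inradius p q s) \<subseteq> convex hull {p, q, s}"
proof -
  let ?d = "\<bar>det2 (q - p) (s - p)\<bar>" and ?P = "dual_norm (q - p) + dual_norm (s - q) + dual_norm (p - s)"
  have P: "0 < ?P" by (rule dual_norm_perimeter_pos [OF d])
  \<comment> \<open>The incentre has barycentric coordinates proportional to the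
    \<open>dual_norm\<close> lengths of the opposite edges, as in the Euclidean case; all three
    tangency conditions then hold with equality.\<close>
  define a b e where "a = dual_norm (s - q) / ?P" and "b = dual_norm (p - s) / ?P" and "e = dual_norm (q - p) / ?P"
  have "a + b + e = 1"
    unfolding a_def b_def e_def using P by (simp flip: add_divide_distrib)
  define c where "c = a *\<^sub>R p + b *\<^sub>R q + e *\<^sub>R s"
  have "bary p q s c = a" unfolding c_def using d \<open>a + b + e = 1\<close> by (rule bary_combination)
  moreover have "bary q s p c = b"
    using bary_combination [of s q p b e a] d \<open>a + b + e = 1\<close> unfolding c_def
    by (simp add: det2_cyclic ac_simps)
  moreover have "bary s p q c = e"
    using bary_combination [of p s q e a b] d \<open>a + b + e = 1\<close> unfolding c_def
    by (simp add: det2_cyclic ac_simps)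
  moreover have "0 \<le> triangle_inradius p q s" using P by (simp add: triangle_inradius_def)
  ultimately have "nball c (triangle_inradius p q s) \<subseteq> convex hull {p, q, s}"
    using d by (simp add: nball_subset_triangle_iff triangle_inradius_def a_def b_def e_def mult.commute)
  then show thesis by (rule that)
qed

lemma inradius_triangle:
  assumes d: "det2 (q - p) (s - p) \<noteq> 0"
  shows "inradius N (convex hull {p, q, s}) = triangle_inradius p q s"
proof (rule antisym)
  have P: "0 < dual_norm (q - p) + dual_norm (s - q) + dual_norm (p - s)" by (rule dual_norm_perimeter_pos [OF d])
  have "compact (convex hull {p, q, s})" by (simp add: finite_imp_compact_convex_hull)
  then show "triangle_inradius p q s \<le> inradius N (convex hull {p, q, s})"
    using inball_triangle [OF d] P by (metis inradius_ge triangle_inradius_def abs_ge_zero divide_nonneg_pos)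
  show "inradius N (convex hull {p, q, s}) \<le> triangle_inradius p q s"
  proof (rule inradius_le)
    fix c r assume r: "0 \<le> r" "nball c r \<subseteq> convex hull {p, q, s}"
    have "r * (dual_norm (q - p) + dual_norm (s - q) + dual_norm (p - s))
      \<le> (bary p q s c + bary q s p c + bary s p q c) * \<bar>det2 (q - p) (s - p)\<bar>"
      using r d by (simp add: nball_subset_triangle_iff distrib_left distrib_right)
    then show "r \<le> triangle_inradius p q s" unfolding bary_sum [OF d] triangle_inradius_def using P by (simp add: pos_le_divide_eq)
  qed simp
qed

section \<open>Behaviour under homotheties\<close>

lemma affine_image_nball:
  assumes "0 < t"
  shows "(\<lambda>x. a + t *\<^sub>R x) ` K \<subseteq> nball c r \<longleftrightarrow> K \<subseteq> nball ((1 / t) *\<^sub>R (c - a)) (r / t)"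
    and "nball c r \<subseteq> (\<lambda>x. a + t *\<^sub>R x) ` K \<longleftrightarrow> nball ((1 / t) *\<^sub>R (c - a)) (r / t) \<subseteq> K"
proof -
  have N: "N (x - (1 / t) *\<^sub>R (c - a)) = N (a + t *\<^sub>R x - c) / t" for x
  proof -
    have "x - (1 / t) *\<^sub>R (c - a) = (1 / t) *\<^sub>R (a + t *\<^sub>R x - c)"
      using assms by (simp add: algebra_simps)
    then show ?thesis using assms by (simp add: N_scale)
  qed
  then have mem: "a + t *\<^sub>R x \<in> nball c r \<longleftrightarrow> x \<in> nball ((1 / t) *\<^sub>R (c - a)) (r / t)" for x
    using assms by (simp add: nball_def divide_le_cancel)
  then show "(\<lambda>x. a + t *\<^sub>R x) ` K \<subseteq> nball c r \<longleftrightarrow> K \<subseteq> nball ((1 / t) *\<^sub>R (c - a)) (r / t)"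
    by blast
  have ex: "\<exists>x. y = a + t *\<^sub>R x" for y
    using assms by (intro exI [of _ "(1 / t) *\<^sub>R (y - a)"]) simp
  show "nball c r \<subseteq> (\<lambda>x. a + t *\<^sub>R x) ` K \<longleftrightarrow> nball ((1 / t) *\<^sub>R (c - a)) (r / t) \<subseteq> K"
  proof
    assume A: "nball c r \<subseteq> (\<lambda>x. a + t *\<^sub>R x) ` K"
    show "nball ((1 / t) *\<^sub>R (c - a)) (r / t) \<subseteq> K"
    proof
      fix x assume "x \<in> nball ((1 / t) *\<^sub>R (c - a)) (r / t)"
      then have "a + t *\<^sub>R x \<in> (\<lambda>x. a + t *\<^sub>R x) ` K" using A mem by blast
      then show "x \<in> K" using assms by auto
    qed
  next
    assume A: "nball ((1 / t) *\<^sub>R (c - a)) (r / t) \<subseteq> K"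
    show "nball c r \<subseteq> (\<lambda>x. a + t *\<^sub>R x) ` K"
    proof
      fix y assume y: "y \<in> nball c r"
      obtain x where x: "y = a + t *\<^sub>R x" using ex by blast
      then have "x \<in> K" using A y mem by blast
      then show "y \<in> (\<lambda>x. a + t *\<^sub>R x) ` K" using x by blast
    qed
  qed
qed

lemma circumradius_affine_le:
  assumes "0 < t" "compact K" "K \<noteq> {}"
  shows "circumradius N ((\<lambda>x. a + t *\<^sub>R x) ` K) \<le> t * circumradius N K"
proof -
  obtain c where c: "K \<subseteq> nball c (circumradius N K)" using circumball_exists assms by blast
  have "(\<lambda>x. a + t *\<^sub>R x) ` K \<subseteq> nball (a + t *\<^sub>R c) (t * circumradius N K)"
    using assms(1) c by (simp add: affine_image_nball)
  then show ?thesis using assms circumradius_nonneg [of K] by (intro circumradius_le) auto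
qed

lemma inradius_affine_ge:
  assumes "0 < t" "compact K" "K \<noteq> {}"
  shows "t * inradius N K \<le> inradius N ((\<lambda>x. a + t *\<^sub>R x) ` K)"
proof -
  have comp: "compact ((\<lambda>x. a + t *\<^sub>R x) ` K)"
    by (intro compact_continuous_image continuous_intros assms)
  have "inradius N K \<le> inradius N ((\<lambda>x. a + t *\<^sub>R x) ` K) / t"
  proof (rule inradius_le [OF assms(3)])
    fix c r assume r: "0 \<le> r" "nball c r \<subseteq> K"
    then have "nball (a + t *\<^sub>R c) (t * r) \<subseteq> (\<lambda>x. a + t *\<^sub>R x) ` K"
      using assms(1) by (simp add: affine_image_nball)
    then have "t * r \<le> inradius N ((\<lambda>x. a + t *\<^sub>R x) ` K)"
      using r assms(1) by (intro inradius_ge [OF comp]) auto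
    then show "r \<le> inradius N ((\<lambda>x. a + t *\<^sub>R x) ` K) / t" using assms(1) by (simp add: field_simps)
  qed
  then show ?thesis using assms(1) by (simp add: field_simps)
qed

lemma norm_diameter_affine_le:
  assumes "0 < t" "compact K" "K \<noteq> {}"
  shows "norm_diameter N ((\<lambda>x. a + t *\<^sub>R x) ` K) \<le> t * norm_diameter N K"
proof (rule norm_diameter_le)
  fix x y assume "x \<in> (\<lambda>x. a + t *\<^sub>R x) ` K" "y \<in> (\<lambda>x. a + t *\<^sub>R x) ` K"
  then obtain x' y' where "x' \<in> K" "y' \<in> K" "x - y = t *\<^sub>R (x' - y')"
    by (auto simp: algebra_simps)
  then show "N (x - y) \<le> t * norm_diameter N K"
    using assms N_le_norm_diameter by (simp add: N_scale)
qed (use assms in simp)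

text \<open>One inequality is known for every homothety with positive factor; applying it to the
  inverse homothety gives the other.\<close>

lemma affine_scaling:
  assumes "0 < t" "compact K" "K \<noteq> {}"
  shows "circumradius N ((\<lambda>x. a + t *\<^sub>R x) ` K) = t * circumradius N K"
    and "inradius N ((\<lambda>x. a + t *\<^sub>R x) ` K) = t * inradius N K"
    and "norm_diameter N ((\<lambda>x. a + t *\<^sub>R x) ` K) = t * norm_diameter N K"
proof -
  let ?L = "(\<lambda>x. a + t *\<^sub>R x) ` K"
  have L: "compact ?L" "?L \<noteq> {}"
    using assms by (auto intro!: compact_continuous_image continuous_intros)
  have K: "K = (\<lambda>x. (- (1 / t) *\<^sub>R a) + (1 / t) *\<^sub>R x) ` ?L"
    using assms(1) by (simp add: image_image algebra_simps)
  have t: "0 < 1 / t" using assms by simp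
  show "circumradius N ?L = t * circumradius N K"
    using circumradius_affine_le [OF assms, of a] assms(1)
      circumradius_affine_le [OF t L, of "- (1 / t) *\<^sub>R a", folded K]
    by (simp add: field_simps)
  show "inradius N ?L = t * inradius N K"
    using inradius_affine_ge [OF assms, of a] assms(1)
      inradius_affine_ge [OF t L, of "- (1 / t) *\<^sub>R a", folded K]
    by (simp add: field_simps)
  show "norm_diameter N ?L = t * norm_diameter N K"
    using norm_diameter_affine_le [OF assms, of a] assms(1)
      norm_diameter_affine_le [OF t L, of "- (1 / t) *\<^sub>R a", folded K]
    by (simp add: field_simps)
qed

subsection \<open>Inscribed triangles\<close>

text \<open>For \<open>d < 2\<close> the condition on \<open>0\<close> says that the unit ball is a smallest enclosing ball.\<close>
definition inscribed :: "real \<Rightarrow> real^2 \<Rightarrow> real^2 \<Rightarrow> real^2 \<Rightarrow> bool" where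
  "inscribed d p q s \<longleftrightarrow> N p = 1 \<and> N q = 1 \<and> N s = 1 \<and>
     N (p - q) \<le> d \<and> N (q - s) \<le> d \<and> N (s - p) \<le> d \<and> 0 \<in> convex hull {p, q, s}"

lemma inscribed_rotate: "inscribed d p q s \<Longrightarrow> inscribed d q s p"
  by (simp add: inscribed_def insert_commute)

lemma inscribed_swap: "inscribed d p q s \<Longrightarrow> inscribed d q p s"
  by (simp add: inscribed_def insert_commute N_commute)

lemma triangle_inradius_rotate: "triangle_inradius p q s = triangle_inradius q s p"
  by (simp add: triangle_inradius_def det2_cyclic ac_simps)

lemma zero_in_hullI:
  fixes p q s :: "real^2"
  assumes "0 \<le> a" "0 \<le> b" "0 \<le> c" "0 < a + b + c" "a *\<^sub>R p + b *\<^sub>R q + c *\<^sub>R s = 0"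
  shows "0 \<in> convex hull {p, q, s}"
proof -
  let ?t = "a + b + c"
  have "(a / ?t) *\<^sub>R p + (b / ?t) *\<^sub>R q + (c / ?t) *\<^sub>R s = (1 / ?t) *\<^sub>R (a *\<^sub>R p + b *\<^sub>R q + c *\<^sub>R s)"
    by (simp add: scaleR_add_right)
  also have "\<dots> = 0" using assms by simp
  finally have "(a / ?t) *\<^sub>R p + (b / ?t) *\<^sub>R q + (c / ?t) *\<^sub>R s = 0" .
  moreover have "a / ?t + b / ?t + c / ?t = 1"
    using assms(4) by (simp flip: add_divide_distrib)
  moreover have "0 \<le> a / ?t" "0 \<le> b / ?t" "0 \<le> c / ?t"
    using assms(1-4) by simp_all
  ultimately show ?thesis
    unfolding convex_hull_3 mem_Collect_eq by metis
qed

text \<open>Comparing norms forces \<open>b = c\<close>, hence \<open>s = - q\<close>.\<close>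

lemma opposite_unit_vectors:
  assumes "b *\<^sub>R q + c *\<^sub>R s = 0" "0 \<le> b" "0 \<le> c" "0 < b + c" "N q = 1" "N s = 1"
  shows "N (q - s) = 2"
proof -
  have eq: "b *\<^sub>R q = - (c *\<^sub>R s)" using assms(1) by (simp add: eq_neg_iff_add_eq_0)
  then have "N (b *\<^sub>R q) = N (c *\<^sub>R s)" by simp
  then have "b = c" using assms by (simp add: N_scale)
  then have "b *\<^sub>R (q + s) = 0" "b \<noteq> 0" using assms by (auto simp: scaleR_add_right)
  then have "q + s = 0" by simp
  then have "s = - q" by (simp add: add_eq_0_iff)
  then have "q - s = 2 *\<^sub>R q" by (simp add: scaleR_2)
  then show ?thesis using assms by (simp add: N_scale)
qed

text \<open>A vanishing coefficient would place 0 on the opposite edge, whose ends would then be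
  antipodal and at distance 2.\<close>

lemma inscribed_coefficients:
  assumes "inscribed d p q s" "d < 2"
  obtains a b c where "0 < a" "0 < b" "0 < c" "a *\<^sub>R p + b *\<^sub>R q + c *\<^sub>R s = 0"
proof -
  obtain a b c where abc: "0 \<le> a" "0 \<le> b" "0 \<le> c" "a + b + c = 1"
    and z: "a *\<^sub>R p + b *\<^sub>R q + c *\<^sub>R s = 0"
    using assms unfolding inscribed_def convex_hull_3 by auto
  have n: "N p = 1" "N q = 1" "N s = 1" "N (p - q) < 2" "N (q - s) < 2" "N (s - p) < 2"
    using assms unfolding inscribed_def by auto
  have "a \<noteq> 0" using opposite_unit_vectors [of b q c s] abc z n by auto
  moreover have "b \<noteq> 0" using opposite_unit_vectors [of c s a p] abc z n by (auto simp: add.commute)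
  moreover have "c \<noteq> 0" using opposite_unit_vectors [of a p b q] abc z n by auto
  ultimately show thesis using that [of a b c] abc z by simp
qed

text \<open>The second claim says that the orientation of the triangle does not depend on
  \<open>s\<close>. It is needed to add absolute areas of triangles over the same edge
  \<open>p, q\<close>.\<close>

lemma inscribed_det2:
  assumes "inscribed d p q s" "d < 2"
  shows "det2 p q \<noteq> 0" and "0 < det2 (q - p) (s - p) * det2 p q"
proof -
  obtain a b c where abc: "0 < a" "0 < b" "0 < c" and z: "a *\<^sub>R p + b *\<^sub>R q + c *\<^sub>R s = 0"
    using inscribed_coefficients assms by blast
  have n: "N p = 1" "N q = 1" "N s = 1" "N (p - q) < 2" "N (q - s) < 2" "N (s - p) < 2"
    using assms unfolding inscribed_def by auto
  show d: "det2 p q \<noteq> 0"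
  proof
    assume "det2 p q = 0"
    moreover have "p \<noteq> 0" using n by auto
    ultimately obtain t where t: "q = t *\<^sub>R p" by (rule det2_eq_0D)
    then have "\<bar>t\<bar> = 1" using n by (simp add: N_scale)
    then consider "t = 1" | "t = -1" by linarith
    then show False
    proof cases
      case 1
      then have "c *\<^sub>R s + (a + b) *\<^sub>R p = 0" using z t by (simp add: algebra_simps)
      then show False using opposite_unit_vectors [of c s "a + b" p] abc n by simp
    next
      case 2
      then have "p - q = 2 *\<^sub>R p" using t by (simp add: scaleR_2)
      then show False using n by (simp add: N_scale)
    qed
  qed
  have s: "c *\<^sub>R s = - (a *\<^sub>R p) - b *\<^sub>R q" using z by (simp add: algebra_simps add_eq_0_iff)
  have "c * det2 (q - p) (s - p) = c * det2 p q - det2 p (c *\<^sub>R s) + det2 q (c *\<^sub>R s)"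
    by (simp add: det2_simps det2_commute [of q p] algebra_simps)
  also have "\<dots> = (a + b + c) * det2 p q"
    unfolding s by (simp add: det2_simps det2_commute [of q p] algebra_simps)
  finally have eq: "c * (det2 (q - p) (s - p) * det2 p q) = (a + b + c) * (det2 p q * det2 p q)"
    by (metis mult.assoc)
  have "0 < det2 p q * det2 p q" using d not_real_square_gt_zero by blast
  then have "0 < c * (det2 (q - p) (s - p) * det2 p q)"
    unfolding eq using abc by (intro mult_pos_pos [of "a + b + c"] add_pos_pos)
  then show "0 < det2 (q - p) (s - p) * det2 p q" using abc by (simp add: zero_less_mult_iff)
qed

lemma inscribed_nondegenerate:
  assumes "inscribed d p q s" "d < 2"
  shows "det2 (q - p) (s - p) \<noteq> 0"
  using inscribed_det2 [OF assms] by auto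

section \<open>Triples for which the unit ball is a smallest enclosing ball\<close>

text \<open>If \<open>\<beta> \<le> \<alpha>\<close>, then \<open>p - x\<close> is
  \<open>(1 + \<alpha>) p + \<beta> q\<close>, whose norm is at least
  \<open>1 + \<alpha> - \<beta>\<close>; otherwise \<open>q\<close> takes the role of
  \<open>p\<close>.\<close>

lemma circumradius_cone:
  assumes "N p = 1" "N q = 1" "x = - (\<alpha> *\<^sub>R p + \<beta> *\<^sub>R q)" "0 \<le> \<alpha>" "0 \<le> \<beta>"
  shows "1 \<le> N (p - x) \<or> 1 \<le> N (q - x)"
proof -
  have *: "1 \<le> N (p - x)" if "N p = 1" "N q = 1" "x = - (\<alpha> *\<^sub>R p + \<beta> *\<^sub>R q)" "0 \<le> \<alpha>" "0 \<le> \<beta>" "\<beta> \<le> \<alpha>"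
    for p q :: "real^2" and \<alpha> \<beta> :: real
  proof -
    have "p - x = (1 + \<alpha>) *\<^sub>R p - (- \<beta>) *\<^sub>R q" unfolding that(3) by (simp add: algebra_simps)
    then have "N ((1 + \<alpha>) *\<^sub>R p) - N ((- \<beta>) *\<^sub>R q) \<le> N (p - x)"
      using N_ge_diff by metis
    then show ?thesis using that by (simp add: N_scale)
  qed
  show ?thesis
    using * [of p q \<alpha> \<beta>] * [of q p \<beta> \<alpha>] assms by (cases "\<beta> \<le> \<alpha>") (auto simp: add.commute)
qed

text \<open>The negatives of the three cones spanned by pairs of the points cover the plane.\<close>
lemma inscribed_circumradius_ge:
  assumes "inscribed d p q s" "d < 2"
  shows "1 \<le> N (p - x) \<or> 1 \<le> N (q - x) \<or> 1 \<le> N (s - x)"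
proof -
  obtain a b c where abc: "0 < a" "0 < b" "0 < c" and z: "a *\<^sub>R p + b *\<^sub>R q + c *\<^sub>R s = 0"
    using inscribed_coefficients assms by blast
  have n: "N p = 1" "N q = 1" "N s = 1" using assms unfolding inscribed_def by auto
  define u v w where "u = bary p q s x" and "v = bary q s p x" and "w = bary s p q x"
  have x: "x = u *\<^sub>R p + v *\<^sub>R q + w *\<^sub>R s"
    unfolding u_def v_def w_def by (rule bary_repr [OF inscribed_nondegenerate [OF assms]])
  have *: "1 \<le> N (p - x) \<or> 1 \<le> N (q - x)"
    if "0 < a" "0 < b" "0 < c" "a *\<^sub>R p + b *\<^sub>R q + c *\<^sub>R s = 0" "N p = 1" "N q = 1"
      "x = u *\<^sub>R p + v *\<^sub>R q + w *\<^sub>R s" "u / a \<le> w / c" "v / b \<le> w / c"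
    for p q s :: "real^2" and a b c u v w :: real
  proof (rule circumradius_cone)
    \<comment> \<open>The vertex with the largest ratio of coordinate to coefficient is eliminated
      by subtracting a multiple of the zero relation; the other two coefficients become nonpositive,
      so \<open>x\<close> lies in a negated cone.\<close>
    have "x = u *\<^sub>R p + v *\<^sub>R q + w *\<^sub>R s - (w / c) *\<^sub>R (a *\<^sub>R p + b *\<^sub>R q + c *\<^sub>R s)"
      using that by simp
    then show "x = - ((w / c * a - u) *\<^sub>R p + (w / c * b - v) *\<^sub>R q)"
      using that(3) by (simp add: algebra_simps)
    show "0 \<le> w / c * a - u" "0 \<le> w / c * b - v"
      using that(1-3,8,9) by (simp_all add: pos_divide_le_eq)
  qed (use that in simp_all)
  consider "u / a \<le> w / c" "v / b \<le> w / c" | "v / b \<le> u / a" "w / c \<le> u / a" | "w / c \<le> v / b" "u / a \<le> v / b"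
    by linarith
  then show ?thesis
  proof cases
    case 1
    then show ?thesis using * [of a b c p q s u v w] abc z n x by blast
  next
    case 2
    then show ?thesis using * [of b c a q s p v w u] abc z n x by (auto simp: ac_simps)
  next
    case 3
    then show ?thesis using * [of c a b s p q w u v] abc z n x by (auto simp: ac_simps)
  qed
qed

text \<open>As the centre moves from 0 to the midpoint of \<open>p\<close> and \<open>q\<close>, its
  distance to \<open>p\<close> is convex: at most 1 at the start and half of
  \<open>N (p - q)\<close>, hence below 1, at the end.\<close>

lemma N_toward_midpoint:
  assumes "N p \<le> 1" "N (p - q) < 2" "0 < t" "t \<le> 1"
  shows "N (p - (t / 2) *\<^sub>R (p + q)) < 1"
proof -
  have "p - (t / 2) *\<^sub>R (p + q) = (1 - t) *\<^sub>R p + (t / 2) *\<^sub>R (p - q)"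
    by (simp add: vec_eq_iff field_simps)
  then have "N (p - (t / 2) *\<^sub>R (p + q)) \<le> \<bar>1 - t\<bar> * N p + \<bar>t / 2\<bar> * N (p - q)"
    using N_combination2 by metis
  also have "\<dots> = (1 - t) * N p + t / 2 * N (p - q)" using assms by simp
  also have "\<dots> \<le> (1 - t) * 1 + t / 2 * N (p - q)"
    using assms by (intro add_mono mult_left_mono) auto
  also have "\<dots> < (1 - t) * 1 + t / 2 * 2"
    using assms by (intro add_strict_left_mono mult_strict_left_mono) auto
  finally show ?thesis by simp
qed

lemma shrink_interior_point:
  assumes "N p \<le> 1" "N q \<le> 1" "N (p - q) < 2" "N s < 1"
  shows "\<exists>x. N (p - x) < 1 \<and> N (q - x) < 1 \<and> N (s - x) < 1"
proof (intro exI conjI)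
  \<comment> \<open>The distance to \<open>s\<close> grows by at most \<open>t\<close>, which uses
    up half of the slack \<open>1 - N s\<close>.\<close>
  define t where "t = (1 - N s) / 2"
  have "0 < t" using assms(4) by (simp add: t_def)
  moreover have "t \<le> 1" using N_nonneg [of s] unfolding t_def by argo
  ultimately have t: "0 < t" "t \<le> 1" .
  let ?x = "(t / 2) *\<^sub>R (p + q)"
  show "N (p - ?x) < 1" using N_toward_midpoint assms t by blast
  show "N (q - ?x) < 1"
    using N_toward_midpoint [of q p t] assms t by (simp add: N_commute add.commute)
  have "N (s - ?x) \<le> N s + t / 2 * N (p + q)"
    using N_triangle_diff [of s ?x] t by (simp add: N_scale)
  also have "\<dots> \<le> N s + t / 2 * 2"
    using N_triangle [of p q] assms t by (intro add_left_mono mult_left_mono) auto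
  also have "\<dots> < 1" unfolding t_def using assms by (simp add: field_simps)
  finally show "N (s - ?x) < 1" .
qed

text \<open>Here all three points lie in one cone spanned by \<open>p\<close> and \<open>s\<close>,
  so a ball around a point slightly towards the midpoint of \<open>p\<close> and \<open>s\<close>
  can be smaller.\<close>

lemma shrink_cone_point:
  assumes n: "N p = 1" "N q = 1" "N s = 1" and d: "N (p - s) < 2"
    and q: "q = \<alpha> *\<^sub>R p + \<beta> *\<^sub>R s" and \<beta>: "0 \<le> \<beta>" "\<beta> \<le> \<alpha>"
  shows "\<exists>x. N (p - x) < 1 \<and> N (q - x) < 1 \<and> N (s - x) < 1"
proof -
  have m: "N (p - (t / 2) *\<^sub>R (p + s)) < 1" "N (s - (t / 2) *\<^sub>R (p + s)) < 1" if "0 < t" "t \<le> 1" for t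
    using N_toward_midpoint [of p s t] N_toward_midpoint [of s p t] n d that
    by (simp_all add: N_commute add.commute)
  show ?thesis
  proof (cases "\<beta> = 0")
    case True
    then have "\<alpha> = 1" using q n \<beta> by (simp add: N_scale)
    then show ?thesis using m [of 1] True q by auto
  next
    case False
    then have b: "0 < \<beta>" using \<beta> by simp
    have "\<alpha> - \<beta> \<le> N q"
      using N_ge_diff [of "\<alpha> *\<^sub>R p" "(- \<beta>) *\<^sub>R s"] q n \<beta> by (simp add: N_scale)
    \<comment> \<open>Equality would give \<open>(1 + 2 * \<beta>) p = q + \<beta> (p - s)\<close>,
      which is too long for the right-hand side because \<open>N (p - s) < 2\<close>.\<close>
    moreover have "\<alpha> - \<beta> \<noteq> 1"
    proof
      assume "\<alpha> - \<beta> = 1"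
      then have "\<alpha> = 1 + \<beta>" by simp
      then have "(1 + 2 * \<beta>) *\<^sub>R p = 1 *\<^sub>R q + \<beta> *\<^sub>R (p - s)"
        using q by (simp add: vec_eq_iff algebra_simps)
      then have "N ((1 + 2 * \<beta>) *\<^sub>R p) \<le> \<bar>1\<bar> * N q + \<bar>\<beta>\<bar> * N (p - s)"
        using N_combination2 [of 1 q \<beta> "p - s"] by simp
      then have "1 + 2 * \<beta> \<le> 1 + \<beta> * N (p - s)" using n b by (simp add: N_scale)
      moreover have "\<beta> * N (p - s) < \<beta> * 2" using b d by (intro mult_strict_left_mono)
      ultimately show False by simp
    qed
    ultimately have ab: "\<alpha> - \<beta> < 1" using n by linarith
    \<comment> \<open>With \<open>t = 2 * \<beta> * \<mu>\<close> the shift removes the fraction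
      \<open>\<mu>\<close> of the \<open>s\<close> part of \<open>q\<close>, and what remains is a
      combination of \<open>q\<close> and \<open>p\<close> alone. The cap 1 is the range allowed by
      \<open>N_toward_midpoint\<close>.\<close>
    define t where "t = min 1 (2 * \<beta>)"
    have t: "0 < t" "t \<le> 1" "t \<le> 2 * \<beta>" unfolding t_def using b by auto
    define \<mu> where "\<mu> = t / (2 * \<beta>)"
    have l: "0 < \<mu>" "\<mu> \<le> 1" "t = 2 * \<beta> * \<mu>" unfolding \<mu>_def using t b by auto
    have "q - (t / 2) *\<^sub>R (p + s) = (1 - \<mu>) *\<^sub>R q + (\<mu> * (\<alpha> - \<beta>)) *\<^sub>R p"
      using l(3) q by (simp add: vec_eq_iff algebra_simps)
    then have "N (q - (t / 2) *\<^sub>R (p + s)) \<le> \<bar>1 - \<mu>\<bar> * N q + \<bar>\<mu> * (\<alpha> - \<beta>)\<bar> * N p"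
      using N_combination2 by metis
    also have "\<dots> = (1 - \<mu>) + \<mu> * (\<alpha> - \<beta>)" using l \<beta> n by simp
    also have "\<dots> < (1 - \<mu>) + \<mu> * 1"
      using l ab by (intro add_strict_left_mono mult_strict_left_mono)
    finally have "N (q - (t / 2) *\<^sub>R (p + s)) < 1" by simp
    then show ?thesis using m [OF t(1,2)] by blast
  qed
qed

lemma shrink_cone_point':
  assumes n: "N p = 1" "N q = 1" "N s = 1" and d: "N (p - s) < 2"
    and z: "a *\<^sub>R p + b *\<^sub>R q + c *\<^sub>R s = 0" and "0 \<le> a" "b < 0" "0 \<le> c"
  shows "\<exists>x. N (p - x) < 1 \<and> N (q - x) < 1 \<and> N (s - x) < 1"
proof -
  have "b *\<^sub>R q = - (a *\<^sub>R p) - c *\<^sub>R s" using z by (simp add: algebra_simps add_eq_0_iff)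
  then have "(1 / b) *\<^sub>R (b *\<^sub>R q) = (1 / b) *\<^sub>R (- (a *\<^sub>R p) - c *\<^sub>R s)" by simp
  then have q: "q = (- a / b) *\<^sub>R p + (- c / b) *\<^sub>R s"
    using \<open>b < 0\<close> by (simp add: scaleR_diff_right)
  have pos: "0 \<le> - a / b" "0 \<le> - c / b" using assms by (auto simp: divide_nonneg_neg divide_le_0_iff)
  show ?thesis
  proof (cases "- c / b \<le> - a / b")
    case True
    then show ?thesis using shrink_cone_point n d q pos by blast
  next
    case False
    then show ?thesis
      using shrink_cone_point [of s q p "- c / b" "- a / b"] n d q pos N_commute [of p s]
      by (auto simp: add.commute)
  qed
qed

text \<open>Converse of \<open>inscribed_circumradius_ge\<close>: if a point were inside the unit
  ball or 0 outside the hull, moving the centre would bring all three distances below 1.\<close>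

lemma inscribedI:
  assumes n: "N p \<le> 1" "N q \<le> 1" "N s \<le> 1"
    and e: "N (p - q) \<le> d" "N (q - s) \<le> d" "N (s - p) \<le> d" and d: "d < 2"
    and no: "\<And>x. 1 \<le> N (p - x) \<or> 1 \<le> N (q - x) \<or> 1 \<le> N (s - x)"
  shows "inscribed d p q s"
proof -
  have no': "\<not> (\<exists>x. N (p - x) < 1 \<and> N (q - x) < 1 \<and> N (s - x) < 1)"
    using no by (metis not_le)
  have d': "N (p - q) < 2" "N (q - s) < 2" "N (s - p) < 2" using e d by linarith+
  have d'': "N (q - p) < 2" "N (s - q) < 2" "N (p - s) < 2"
    using d' N_commute [of q p] N_commute [of s q] N_commute [of p s] by auto
  have u: "N p = 1" "N q = 1" "N s = 1"
    using shrink_interior_point [of p q s] shrink_interior_point [of q s p]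
      shrink_interior_point [of s p q] n d' no' by (meson le_less)+
  have "0 \<in> convex hull {p, q, s}"
  proof (rule ccontr)
    assume H: "0 \<notin> convex hull {p, q, s}"
    \<comment> \<open>Cramer's rule: these determinants always give a linear relation between three
      plane vectors. Their signs decide whether 0 is in the hull.\<close>
    define a b c where "a = det2 q s" and "b = det2 s p" and "c = det2 p q"
    have z: "a *\<^sub>R p + b *\<^sub>R q + c *\<^sub>R s = 0"
      by (simp add: a_def b_def c_def vec_eq_iff forall_2 det2_def algebra_simps)
    then have z': "(- a) *\<^sub>R p + (- b) *\<^sub>R q + (- c) *\<^sub>R s = 0"
      by (simp add: algebra_simps add_eq_0_iff)
    \<comment> \<open>If all vanish, the points lie on one line through 0; being unit vectors less
      than 2 apart, they coincide, and \<open>p\<close> itself is a centre at distance 0.\<close>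
    have nz: "a \<noteq> 0 \<or> b \<noteq> 0 \<or> c \<noteq> 0"
    proof (rule ccontr)
      assume "\<not> (a \<noteq> 0 \<or> b \<noteq> 0 \<or> c \<noteq> 0)"
      then have 0: "det2 p q = 0" "det2 p s = 0"
        by (auto simp: b_def c_def det2_commute [of s p])
      have p: "p \<noteq> 0" using u by auto
      have eq: "w = p" if "det2 p w = 0" "N w = 1" "N (p - w) < 2" for w
      proof -
        note w = that
        obtain t where t: "w = t *\<^sub>R p" by (rule det2_eq_0D [OF w(1) p])
        then have "\<bar>t\<bar> = 1" using w u by (simp add: N_scale)
        moreover have "t \<noteq> -1"
        proof
          assume "t = -1"
          then have "p - w = 2 *\<^sub>R p" using t by (simp add: scaleR_2)
          then show False using w u by (simp add: N_scale)
        qed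
        ultimately have "t = 1" by linarith
        then show ?thesis using t by simp
      qed
      have "q = p" "s = p" using eq 0 u d' d'' by blast+
      then show False using no [of p] by simp
    qed
    have "\<not> (0 \<le> a \<and> 0 \<le> b \<and> 0 \<le> c)"
      using zero_in_hullI [OF _ _ _ _ z] nz H by force
    moreover have "\<not> (a \<le> 0 \<and> b \<le> 0 \<and> c \<le> 0)"
      using zero_in_hullI [OF _ _ _ _ z'] nz H by force
    \<comment> \<open>A relation with mixed signs has, possibly after negating it, exactly one
      negative coefficient. That vertex lies in the cone of the other two.\<close>
    ultimately consider "0 \<le> a" "b < 0" "0 \<le> c" | "0 \<le> b" "c < 0" "0 \<le> a" | "0 \<le> c" "a < 0" "0 \<le> b"
      | "0 \<le> - a" "- b < 0" "0 \<le> - c" | "0 \<le> - b" "- c < 0" "0 \<le> - a" | "0 \<le> - c" "- a < 0" "0 \<le> - b"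
      by linarith
    then show False
    proof cases
      case 1
      then show False using shrink_cone_point' [of p q s a b c] u d'' z no' by blast
    next
      case 2
      then show False using shrink_cone_point' [of q s p b c a] u d'' z no' by (auto simp: ac_simps)
    next
      case 3
      then show False using shrink_cone_point' [of s p q c a b] u d'' z no' by (auto simp: ac_simps)
    next
      case 4
      then show False using shrink_cone_point' [of p q s "- a" "- b" "- c"] u d'' z' no' by blast
    next
      case 5
      have "(- b) *\<^sub>R q + (- c) *\<^sub>R s + (- a) *\<^sub>R p = 0" using z' by (simp only: ac_simps)
      then show False using 5 shrink_cone_point' [of q s p "- b" "- c" "- a"] u d'' no' by blast
    next
      case 6
      have "(- c) *\<^sub>R s + (- a) *\<^sub>R p + (- b) *\<^sub>R q = 0" using z' by (simp only: ac_simps)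
      then show False using 6 shrink_cone_point' [of s p q "- c" "- a" "- b"] u d'' no' by blast
    qed
  qed
  then show ?thesis using u e by (simp add: inscribed_def)
qed

section \<open>Moving one vertex along the unit sphere\<close>

text \<open>The diagonals of the quadrilateral with vertices \<open>0, q, x, s\<close> meet in a point \<open>i\<close>;
  the triangle inequality is applied to both halves of each diagonal.\<close>
lemma monotonicity:
  assumes n: "N q = 1" "N s = 1" "N x = 1" and x: "x = \<sigma> *\<^sub>R s + \<tau> *\<^sub>R q" "0 \<le> \<sigma>" "0 \<le> \<tau>"
  shows "N (x - q) \<le> N (s - q)"
proof -
  let ?t = "\<sigma> + \<tau>"
  \<comment> \<open>This puts \<open>i\<close> on the segment from 0 to \<open>x\<close>, not beyond
    \<open>x\<close>.\<close>
  have t: "1 \<le> ?t" using N_combination2 [of \<sigma> s \<tau> q] x n by simp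
  define i where "i = (1 / ?t) *\<^sub>R x"
  have "x - i = (1 - 1 / ?t) *\<^sub>R x" by (simp add: i_def algebra_simps)
  then have 1: "N (x - i) + N i = 1" using t n by (simp add: i_def N_scale)
  have i: "i - r = (1 / ?t) *\<^sub>R (x - ?t *\<^sub>R r)" for r
    using t by (simp add: i_def scaleR_diff_right)
  have "i - q = (1 / ?t) *\<^sub>R (\<sigma> *\<^sub>R (s - q))" "i - s = (1 / ?t) *\<^sub>R (\<tau> *\<^sub>R (q - s))"
    unfolding i x(1) by (simp_all add: algebra_simps)
  then have "i - q = (\<sigma> / ?t) *\<^sub>R (s - q)" "i - s = (\<tau> / ?t) *\<^sub>R (q - s)"
    by simp_all
  then have "N (i - q) + N (i - s) = (\<sigma> / ?t + \<tau> / ?t) * N (s - q)"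
    using x t N_commute [of q s] by (simp add: N_scale distrib_right)
  also have "\<sigma> / ?t + \<tau> / ?t = 1" using t by (simp flip: add_divide_distrib)
  finally have 2: "N (i - q) + N (i - s) = N (s - q)" by simp
  have "N (x - q) \<le> N (x - i) + N (i - q)" by (rule N_triangle_mid)
  moreover have "N s \<le> N (i - s) + N i" using N_triangle_mid [of s 0 i] N_commute [of s i] by simp
  ultimately show ?thesis using 1 2 n by linarith
qed

text \<open>The vertex travels from \<open>s\<close> to \<open>- p\<close>, so its distance to
  \<open>p\<close> passes from at most \<open>d\<close> to 2 and equals \<open>d\<close> somewhere.
  The path stays in the cone of \<open>s\<close> and \<open>q\<close>, since \<open>- p\<close>
  belongs to that cone; hence \<open>monotonicity\<close> controls the edge to
  \<open>q\<close>.\<close>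

lemma move_vertex:
  assumes I: "inscribed d p q s" and d: "d < 2"
  obtains x \<sigma> \<tau> where "0 < \<sigma>" "0 \<le> \<tau>" "x = \<sigma> *\<^sub>R s - \<tau> *\<^sub>R p" "N (x - p) = d" "inscribed d p q x"
proof -
  obtain a b c where abc: "0 < a" "0 < b" "0 < c" and z: "a *\<^sub>R p + b *\<^sub>R q + c *\<^sub>R s = 0"
    using inscribed_coefficients assms by blast
  have n: "N p = 1" "N q = 1" "N s = 1" "N (p - q) \<le> d" "N (q - s) \<le> d" "N (s - p) \<le> d"
    using I unfolding inscribed_def by auto
  \<comment> \<open>The chord from \<open>s\<close> to \<open>- p\<close> misses 0 because
    \<open>s\<close> and \<open>p\<close> are independent; its radial projection \<open>f\<close> is
    the path on the sphere.\<close>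
  define w where "w t = (1 - t) *\<^sub>R s - t *\<^sub>R p" for t
  have w0: "w t \<noteq> 0" for t
  proof
    assume w: "w t = 0"
    have "det2 (w t) p = (1 - t) * det2 s p" by (simp add: w_def det2_simps)
    moreover have "det2 s p \<noteq> 0"
      using inscribed_det2(1) [OF inscribed_rotate [OF inscribed_rotate [OF I]] d] .
    ultimately have "t = 1" using w by (simp add: det2_simps)
    then show False using w n(1) by (auto simp: w_def)
  qed
  define f where "f t = (1 / N (w t)) *\<^sub>R w t" for t
  have "continuous_on {0..1} (\<lambda>t. N (f t - p))"
    unfolding f_def w_def using w0 unfolding w_def
    by (intro continuous_intros) auto
  moreover have "N (f 0 - p) \<le> d" using n by (simp add: f_def w_def)
  moreover have f1: "N (f 1 - p) = 2"
  proof -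
    have "f 1 - p = (- 2) *\<^sub>R p" using n by (simp add: f_def w_def scaleR_2)
    then show ?thesis using n by (simp only: N_scale)
  qed
  ultimately obtain t where t: "0 \<le> t" "t \<le> 1" "N (f t - p) = d"
    using IVT' [of "\<lambda>t. N (f t - p)" 0 d 1] d by auto
  have wp: "0 < N (w t)" using w0 [of t] N_eq_0 [of "w t"] N_nonneg [of "w t"] by linarith
  define \<sigma> \<tau> where "\<sigma> = (1 - t) / N (w t)" and "\<tau> = t / N (w t)"
  have x: "f t = \<sigma> *\<^sub>R s - \<tau> *\<^sub>R p"
    unfolding f_def \<sigma>_def \<tau>_def by (simp add: w_def scaleR_diff_right)
  have "t \<noteq> 1" using t(3) f1 d by auto
  then have \<sigma>: "0 < \<sigma>" unfolding \<sigma>_def using t wp by simp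
  have \<tau>: "0 \<le> \<tau>" unfolding \<tau>_def using t wp by simp
  have nx: "N (f t) = 1" using w0 by (simp add: f_def N_scale)
  \<comment> \<open>The zero relation replaces \<open>- p\<close> by a nonnegative combination of
    \<open>q\<close> and \<open>s\<close>.\<close>
  have "f t = (\<sigma> + \<tau> * c / a) *\<^sub>R s + (\<tau> * b / a) *\<^sub>R q"
  proof -
    have "f t = f t + (\<tau> / a) *\<^sub>R (a *\<^sub>R p + b *\<^sub>R q + c *\<^sub>R s)" using z by simp
    then show ?thesis unfolding x using abc by (simp add: algebra_simps)
  qed
  then have "N (f t - q) \<le> N (s - q)"
    by (rule monotonicity [OF n(2,3) nx]) (use \<sigma> \<tau> abc in auto)
  then have e: "N (q - f t) \<le> d" using n N_commute [of q s] N_commute [of q "f t"] by simp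
  \<comment> \<open>The old relation times \<open>\<sigma>\<close>, with the multiple of
    \<open>s\<close> rewritten through the new vertex; it keeps 0 in the hull.\<close>
  have "(a * \<sigma> + c * \<tau>) *\<^sub>R p + (b * \<sigma>) *\<^sub>R q + c *\<^sub>R f t = \<sigma> *\<^sub>R (a *\<^sub>R p + b *\<^sub>R q + c *\<^sub>R s)"
    unfolding x by (simp add: algebra_simps)
  then have "(a * \<sigma> + c * \<tau>) *\<^sub>R p + (b * \<sigma>) *\<^sub>R q + c *\<^sub>R f t = 0" using z by simp
  then have "0 \<in> convex hull {p, q, f t}"
    using abc \<sigma> \<tau> by (intro zero_in_hullI [of "a * \<sigma> + c * \<tau>" "b * \<sigma>" c]) (auto intro: add_pos_nonneg add_nonneg_pos)
  then have "inscribed d p q (f t)" using n nx e t(3) by (simp add: inscribed_def)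
  then show thesis using that [OF \<sigma> \<tau> x t(3)] by blast
qed

text \<open>Superlevel form: for nonnegative \<open>\<rho>\<close> it compares a convex left side
  with a right side affine on one orientation, which is where quasi-concavity comes from.\<close>

lemma triangle_inradius_ge_iff:
  assumes "det2 (q - p) (s - p) \<noteq> 0"
  shows "\<rho> \<le> triangle_inradius p q s \<longleftrightarrow> \<rho> * (dual_norm (q - p) + dual_norm (s - q) + dual_norm (p - s)) \<le> \<bar>det2 (q - p) (s - p)\<bar>"
  unfolding triangle_inradius_def using dual_norm_perimeter_pos [OF assms] by (simp add: pos_le_divide_eq)

text \<open>Twice the area is affine and the perimeter is convex in a single vertex, so the inradius is
  quasi-concave; a point of the segment \<open>[x, y]\<close> lies on the segment from \<open>0\<close> to \<open>s\<close>, hence inside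
  the old triangle.\<close>
lemma improve_vertex:
  assumes I: "inscribed d p q s" and d: "d < 2"
  obtains x where "inscribed d p q x" "triangle_inradius p q x \<le> triangle_inradius p q s" "N (x - p) = d \<or> N (q - x) = d"
proof -
  interpret dual: normed_plane dual_norm by (rule normed_plane_dual_norm)
  obtain a b c where abc: "0 < a" "0 < b" "0 < c" and z: "a *\<^sub>R p + b *\<^sub>R q + c *\<^sub>R s = 0"
    using inscribed_coefficients assms by blast
  have n: "N s = 1" using I by (simp add: inscribed_def)
  obtain x \<sigma> \<tau> where x: "0 < \<sigma>" "0 \<le> \<tau>" "x = \<sigma> *\<^sub>R s - \<tau> *\<^sub>R p" "N (x - p) = d" "inscribed d p q x"
    using move_vertex [OF I d] by metis
  obtain y \<sigma>' \<tau>' where y: "0 < \<sigma>'" "0 \<le> \<tau>'" "y = \<sigma>' *\<^sub>R s - \<tau>' *\<^sub>R q" "N (y - q) = d" "inscribed d q p y"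
    using move_vertex [OF inscribed_swap [OF I] d] by metis
  have y': "inscribed d p q y" "N (q - y) = d" using y inscribed_swap N_commute by auto
  have nxy: "N x = 1" "N y = 1" using x y by (auto simp: inscribed_def)
  \<comment> \<open>The weights \<open>a * \<tau>'\<close> and \<open>b * \<tau>\<close> make the
    \<open>p\<close> and \<open>q\<close> parts of \<open>x\<close> and \<open>y\<close> add up to a
    multiple of \<open>a p + b q = - c s\<close>, so the weighted mean \<open>w\<close> is on the
    ray of \<open>s\<close>. If \<open>k = 0\<close>, then \<open>x = s\<close> already.\<close>
  define k where "k = a * \<tau>' + b * \<tau>"
  have k0: "0 \<le> k" unfolding k_def using abc x y by simp
  show thesis
  proof (cases "k = 0")
    case True
    then have "\<tau> = 0" unfolding k_def using abc x y
      by (metis add_nonneg_eq_0_iff less_le mult_eq_0_iff mult_nonneg_nonneg)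
    then have "x = s" using x n nxy by (auto simp: N_scale)
    then show thesis using that [of x] x by simp
  next
    case False
    then have k: "0 < k" using k0 by simp
    define u v where "u = a * \<tau>' / k" and "v = b * \<tau> / k"
    have uv: "0 \<le> u" "0 \<le> v" "u + v = 1"
      unfolding u_def v_def using k abc x y by (auto simp flip: add_divide_distrib simp: k_def)
    define w \<omega> where "w = u *\<^sub>R x + v *\<^sub>R y" and "\<omega> = u * \<sigma> + v * \<sigma>' + \<tau> * \<tau>' * c / k"
    have ku: "k * u = a * \<tau>'" "k * v = b * \<tau>" using k by (simp_all add: u_def v_def)
    have "k * \<omega> = (k * u) * \<sigma> + (k * v) * \<sigma>' + \<tau> * \<tau>' * c"
      unfolding \<omega>_def using k by (simp add: distrib_left)
    then have k\<omega>: "k * \<omega> = a * \<tau>' * \<sigma> + b * \<tau> * \<sigma>' + \<tau> * \<tau>' * c" unfolding ku .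
    have "k *\<^sub>R w = (k * u) *\<^sub>R x + (k * v) *\<^sub>R y" by (simp add: w_def scaleR_add_right)
    also have "\<dots> = (k * \<omega>) *\<^sub>R s - (\<tau> * \<tau>') *\<^sub>R (a *\<^sub>R p + b *\<^sub>R q + c *\<^sub>R s)"
      unfolding ku k\<omega> x(3) y(3) by (simp add: algebra_simps)
    finally have "k *\<^sub>R w = k *\<^sub>R (\<omega> *\<^sub>R s) - (\<tau> * \<tau>') *\<^sub>R (a *\<^sub>R p + b *\<^sub>R q + c *\<^sub>R s)"
      by simp
    then have "k *\<^sub>R w = k *\<^sub>R (\<omega> *\<^sub>R s)" unfolding z by simp
    then have w: "w = \<omega> *\<^sub>R s" using k scaleR_left_imp_eq [of k w "\<omega> *\<^sub>R s"] by auto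
    have "0 < u * \<sigma> + v * \<sigma>'"
    proof (cases "u = 0")
      case True
      then show ?thesis using uv y(1) by simp
    next
      case False
      then show ?thesis using uv x(1) y(1) by (intro add_pos_nonneg) auto
    qed
    moreover have "0 \<le> \<tau> * \<tau>' * c / k" using x(2) y(2) abc k by simp
    ultimately have \<omega>: "0 < \<omega>" unfolding \<omega>_def by linarith
    \<comment> \<open>Both ends are unit vectors, so \<open>w\<close> stays in the ball and cannot
      lie beyond \<open>s\<close> on the ray.\<close>
    have "N w \<le> 1" using N_combination2 [of u x v y] uv nxy by (simp add: w_def)
    then have \<omega>1: "\<omega> \<le> 1" using \<omega> n by (simp add: w N_scale)
    have "(1 - \<omega>) *\<^sub>R 0 + \<omega> *\<^sub>R s \<in> convex hull {p, q, s}"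
      using I \<omega> \<omega>1 by (intro convexD [OF convex_convex_hull]) (auto simp: inscribed_def hull_inc)
    then have wh: "w \<in> convex hull {p, q, s}" using w by simp
    have sub: "convex hull {p, q, w} \<subseteq> convex hull {p, q, s}"
      using wh by (intro hull_minimal) (auto simp: hull_inc)
    let ?D = "\<lambda>t. det2 (q - p) (t - p)" and ?P = "\<lambda>t. dual_norm (q - p) + dual_norm (t - q) + dual_norm (p - t)"
    have affine: "w - r = u *\<^sub>R (x - r) + v *\<^sub>R (y - r)" for r
    proof -
      have "w - r = w - (u + v) *\<^sub>R r" using uv by simp
      then show ?thesis by (simp add: w_def algebra_simps)
    qed
    have D: "?D w = u * ?D x + v * ?D y" unfolding affine by (simp add: det2_simps)
    \<comment> \<open>Both triangles have the orientation of \<open>p, q\<close>, so absolute areas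
      add without cancellation.\<close>
    have sg: "0 < ?D x * det2 p q" "0 < ?D y * det2 p q"
      using inscribed_det2(2) x y' d by blast+
    have Dabs: "\<bar>?D w\<bar> = u * \<bar>?D x\<bar> + v * \<bar>?D y\<bar>"
    proof (cases "0 < det2 p q")
      case True
      then have "0 < ?D x" "0 < ?D y" using sg by (simp_all add: zero_less_mult_iff)
      then show ?thesis unfolding D using uv by (simp add: abs_of_nonneg)
    next
      case False
      then have "?D x < 0" "?D y < 0" using sg by (auto simp: zero_less_mult_iff)
      then have "u * ?D x \<le> 0" "v * ?D y \<le> 0" using uv by (simp_all add: mult_nonneg_nonpos)
      then show ?thesis unfolding D using \<open>?D x < 0\<close> \<open>?D y < 0\<close> by simp
    qed
    have nz: "?D x \<noteq> 0" "?D y \<noteq> 0" using sg by auto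
    have "0 < u * \<bar>?D x\<bar> + v * \<bar>?D y\<bar>"
    proof (cases "u = 0")
      case True
      then show ?thesis using uv nz by simp
    next
      case False
      then show ?thesis using uv nz by (intro add_pos_nonneg) auto
    qed
    then have nzw: "?D w \<noteq> 0" using Dabs by auto
    have P: "?P w \<le> u * ?P x + v * ?P y"
    proof -
      have "dual_norm (w - q) \<le> u * dual_norm (x - q) + v * dual_norm (y - q)"
        unfolding affine using dual.N_combination2 [of u "x - q" v "y - q"] uv by simp
      moreover have "dual_norm (w - p) \<le> u * dual_norm (x - p) + v * dual_norm (y - p)"
        unfolding affine using dual.N_combination2 [of u "x - p" v "y - p"] uv by simp
      moreover have "dual_norm (q - p) = u * dual_norm (q - p) + v * dual_norm (q - p)"
        using uv by (simp flip: distrib_right)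
      ultimately show ?thesis
        using dual.N_commute [of p] by (simp add: distrib_left)
    qed
    define \<rho> where "\<rho> = min (triangle_inradius p q x) (triangle_inradius p q y)"
    have \<rho>0: "0 \<le> \<rho>" unfolding \<rho>_def triangle_inradius_def using dual_norm_nonneg by simp
    have "\<rho> * ?P x \<le> \<bar>?D x\<bar>" "\<rho> * ?P y \<le> \<bar>?D y\<bar>"
      using triangle_inradius_ge_iff [OF nz(1), of \<rho>] triangle_inradius_ge_iff [OF nz(2), of \<rho>] by (simp_all add: \<rho>_def)
    then have "u * (\<rho> * ?P x) + v * (\<rho> * ?P y) \<le> u * \<bar>?D x\<bar> + v * \<bar>?D y\<bar>"
      using uv by (intro add_mono mult_left_mono)
    moreover have "\<rho> * ?P w \<le> \<rho> * (u * ?P x + v * ?P y)" using P \<rho>0 by (rule mult_left_mono)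
    ultimately have "\<rho> * ?P w \<le> \<bar>?D w\<bar>" unfolding Dabs by (simp add: algebra_simps)
    then have "\<rho> \<le> triangle_inradius p q w" using triangle_inradius_ge_iff [OF nzw] by simp
    also have "\<dots> \<le> triangle_inradius p q s"
      using inradius_mono [OF _ sub] inradius_triangle [OF nzw]
        inradius_triangle [OF inscribed_nondegenerate [OF I d]]
      by (simp add: finite_imp_compact_convex_hull)
    finally have "triangle_inradius p q x \<le> triangle_inradius p q s \<or> triangle_inradius p q y \<le> triangle_inradius p q s" unfolding \<rho>_def by linarith
    then show thesis using that x y' by blast
  qed
qed

text \<open>The first move produces an edge of length \<open>d\<close>. The second keeps both ends
  of this edge fixed and moves the remaining vertex, so the first gain survives.\<close>

lemma improve_isosceles:
  assumes I: "inscribed d p q s" and d: "d < 2"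
  obtains p' q' s' where "inscribed d p' q' s'" "triangle_inradius p' q' s' \<le> triangle_inradius p q s"
    "N (p' - q') = d" "N (s' - p') = d \<or> N (q' - s') = d"
proof -
  obtain x where x: "inscribed d p q x" "triangle_inradius p q x \<le> triangle_inradius p q s" "N (x - p) = d \<or> N (q - x) = d"
    using improve_vertex [OF I d] by blast
  from x(3) show thesis
  proof
    assume e: "N (x - p) = d"
    obtain y where y: "inscribed d x p y" "triangle_inradius x p y \<le> triangle_inradius x p q" "N (y - x) = d \<or> N (p - y) = d"
      using improve_vertex [OF inscribed_rotate [OF inscribed_rotate [OF x(1)]] d] by blast
    have "triangle_inradius x p y \<le> triangle_inradius p q s" using y(2) x(2) triangle_inradius_rotate [of x p q] by linarith
    then show thesis using that y e by blast
  next
    assume e: "N (q - x) = d"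
    obtain y where y: "inscribed d q x y" "triangle_inradius q x y \<le> triangle_inradius q x p" "N (y - q) = d \<or> N (x - y) = d"
      using improve_vertex [OF inscribed_rotate [OF x(1)] d] by blast
    have "triangle_inradius q x y \<le> triangle_inradius p q s" using y(2) x(2) triangle_inradius_rotate [of p q x] by linarith
    then show thesis using that y e by blast
  qed
qed

subsection \<open>Critical triples of a body\<close>

text \<open>The triples in \<open>K\<close> that no ball of radius below \<open>\<rho>\<close>
  contains. The form with \<open>max\<close> exhibits a closed set;
  \<open>mem_critical_triples\<close> gives the disjunctive form.\<close>

definition critical_triples :: "(real^2) set \<Rightarrow> real \<Rightarrow> ((real^2) \<times> (real^2) \<times> (real^2)) set" where
  "critical_triples K \<rho> = {z \<in> K \<times> K \<times> K. \<forall>x. \<rho> \<le>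
     max (N (fst z - x)) (max (N (fst (snd z) - x)) (N (snd (snd z) - x)))}"

lemma mem_critical_triples:
  "(p, q, s) \<in> critical_triples K \<rho> \<longleftrightarrow> p \<in> K \<and> q \<in> K \<and> s \<in> K \<and>
     (\<forall>x. \<rho> \<le> N (p - x) \<or> \<rho> \<le> N (q - x) \<or> \<rho> \<le> N (s - x))"
  by (auto simp: critical_triples_def le_max_iff_disj)

lemma compact_critical_triples: "compact K \<Longrightarrow> compact (critical_triples K \<rho>)"
proof -
  assume K: "compact K"
  have "critical_triples K \<rho> = (K \<times> K \<times> K) \<inter> (\<Inter>x. {z. \<rho> \<le>
     max (N (fst z - x)) (max (N (fst (snd z) - x)) (N (snd (snd z) - x)))})"
    by (auto simp: critical_triples_def)
  moreover have "closed (\<Inter>x. {z :: (real^2) \<times> (real^2) \<times> (real^2). \<rho> \<le>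
     max (N (fst z - x)) (max (N (fst (snd z) - x)) (N (snd (snd z) - x)))})"
    by (intro closed_INT ballI closed_Collect_le continuous_intros)
  ultimately show ?thesis using K by (simp add: compact_Int_closed compact_Times)
qed

text \<open>Replaces the hull condition by closed conditions on a compact set; both the minimiser
  and the comparison with the Jung constant use it.\<close>

lemma inscribed_iff_critical_triples:
  assumes "d < 2"
  shows "inscribed d p q s \<longleftrightarrow> (p, q, s) \<in> critical_triples (nball 0 1) 1 \<and>
    N (p - q) \<le> d \<and> N (q - s) \<le> d \<and> N (s - p) \<le> d"
proof
  assume I: "inscribed d p q s"
  then show "(p, q, s) \<in> critical_triples (nball 0 1) 1 \<and> N (p - q) \<le> d \<and> N (q - s) \<le> d \<and> N (s - p) \<le> d"
    using inscribed_circumradius_ge [OF I assms] by (auto simp: mem_critical_triples inscribed_def nball_def)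
next
  assume "(p, q, s) \<in> critical_triples (nball 0 1) 1 \<and> N (p - q) \<le> d \<and> N (q - s) \<le> d \<and> N (s - p) \<le> d"
  then show "inscribed d p q s"
    using assms by (intro inscribedI) (auto simp: mem_critical_triples nball_def)
qed

lemma inscribed_minimizer:
  assumes I: "inscribed d p0 q0 s0" and d: "d < 2"
  obtains p q s where "inscribed d p q s"
    "\<And>p' q' s'. inscribed d p' q' s' \<Longrightarrow> triangle_inradius p q s \<le> triangle_inradius p' q' s'"
proof -
  interpret dual: normed_plane dual_norm by (rule normed_plane_dual_norm)
  define S where "S = critical_triples (nball 0 1) 1 \<inter> {z. N (fst z - fst (snd z)) \<le> d} \<inter>
    {z. N (fst (snd z) - snd (snd z)) \<le> d} \<inter> {z. N (snd (snd z) - fst z) \<le> d}"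
  have S: "(p, q, s) \<in> S \<longleftrightarrow> inscribed d p q s" for p q s
    unfolding inscribed_iff_critical_triples [OF d] by (auto simp: S_def)
  have "compact S"
    unfolding S_def
    by (intro compact_Int_closed compact_critical_triples compact_nball closed_Collect_le continuous_intros)
  moreover have "S \<noteq> {}" using S I by blast
  moreover have "continuous_on S (\<lambda>z. triangle_inradius (fst z) (fst (snd z)) (snd (snd z)))"
    unfolding triangle_inradius_def
  proof (intro continuous_intros dual.continuous_on_N ballI)
    fix z assume "z \<in> S"
    then have "inscribed d (fst z) (fst (snd z)) (snd (snd z))" using S by (metis prod.collapse)
    then show "dual_norm (fst (snd z) - fst z) + dual_norm (snd (snd z) - fst (snd z)) + dual_norm (fst z - snd (snd z)) \<noteq> 0"
      using dual_norm_perimeter_pos inscribed_nondegenerate d by (metis less_irrefl)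
  qed
  ultimately obtain z where z: "z \<in> S"
    "\<And>y. y \<in> S \<Longrightarrow> triangle_inradius (fst z) (fst (snd z)) (snd (snd z)) \<le> triangle_inradius (fst y) (fst (snd y)) (snd (snd y))"
    using continuous_attains_inf [of S "\<lambda>z. triangle_inradius (fst z) (fst (snd z)) (snd (snd z))"] by blast
  show thesis
  proof (rule that)
    show "inscribed d (fst z) (fst (snd z)) (snd (snd z))" using S z(1) by (metis prod.collapse)
    show "triangle_inradius (fst z) (fst (snd z)) (snd (snd z)) \<le> triangle_inradius p' q' s'" if "inscribed d p' q' s'" for p' q' s'
      using z(2) [of "(p', q', s')"] S that by simp
  qed
qed

text \<open>Otherwise any three balls of radius \<open>\<rho>\<close> around points of
  \<open>K\<close> meet. Helly's theorem and compactness give a point in all of them, which is the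
  centre of a ball of radius \<open>\<rho>\<close> around \<open>K\<close>, contrary to the
  circumradius.\<close>

lemma critical_triples_nonempty:
  assumes K: "compact K" "K \<noteq> {}" and \<rho>: "0 \<le> \<rho>" "\<rho> < circumradius N K"
  shows "critical_triples K \<rho> \<noteq> {}"
proof
  assume E: "critical_triples K \<rho> = {}"
  have three: "nball p \<rho> \<inter> nball q \<rho> \<inter> nball s \<rho> \<noteq> {}" if pqs: "p \<in> K" "q \<in> K" "s \<in> K" for p q s
  proof -
    have "(p, q, s) \<notin> critical_triples K \<rho>" using E by simp
    then obtain x where "N (p - x) < \<rho>" "N (q - x) < \<rho>" "N (s - x) < \<rho>"
      using pqs by (auto simp: mem_critical_triples not_le)
    then have "x \<in> nball p \<rho> \<inter> nball q \<rho> \<inter> nball s \<rho>" by (simp add: nball_def N_commute)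
    then show ?thesis by blast
  qed
  let ?F = "(\<lambda>p. nball p \<rho>) ` K"
  have small: "\<Inter>T \<noteq> {}" if T: "T \<subseteq> ?F" "finite T" "card T \<le> 3" for T
  proof -
    \<comment> \<open>Smaller families are padded to three balls, repetitions allowed.\<close>
    have "\<exists>A B C. A \<in> ?F \<and> B \<in> ?F \<and> C \<in> ?F \<and> T \<subseteq> {A, B, C}"
    proof -
      obtain A0 where A0: "A0 \<in> ?F" using K(2) by blast
      consider "card T = 0" | "card T = 1" | "card T = 2" | "card T = 3" using T(3) by linarith
      then show ?thesis
      proof cases
        case 1
        then have "T = {}" using T(2) by simp
        then show ?thesis using A0 by blast
      next
        case 2
        then obtain A where A: "T = {A}" by (metis card_1_singletonE)
        then have "A \<in> ?F" using T(1) by blast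
        then show ?thesis using A by (intro exI [of _ A]) simp
      next
        case 3
        then obtain A B where AB: "T = {A, B}" by (auto simp: card_2_iff)
        then have "A \<in> ?F" "B \<in> ?F" using T(1) by blast+
        then show ?thesis using AB by (intro exI [of _ A] exI [of _ B]) simp
      next
        case 4
        then obtain A B C where ABC: "T = {A, B, C}" by (auto simp: card_3_iff)
        then have "A \<in> ?F" "B \<in> ?F" "C \<in> ?F" using T(1) by blast+
        then show ?thesis using ABC by blast
      qed
    qed
    then obtain p q s where "p \<in> K" "q \<in> K" "s \<in> K" "T \<subseteq> {nball p \<rho>, nball q \<rho>, nball s \<rho>}" by blast
    moreover obtain x where "x \<in> nball p \<rho> \<inter> nball q \<rho> \<inter> nball s \<rho>"
      using three [OF calculation(1-3)] by blast
    ultimately have "x \<in> \<Inter>T" by blast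
    then show ?thesis by blast
  qed
  have fin: "\<Inter>T \<noteq> {}" if T: "T \<subseteq> ?F" "finite T" for T
  proof (cases "card T \<le> 3")
    case True
    then show ?thesis using small T by blast
  next
    case False
    show ?thesis
    proof (rule Helly)
      show "DIM(real^2) + 1 \<le> card T" using False by simp
      show "\<forall>s\<in>T. convex s" using T(1) convex_nball by auto
      show "\<Inter>t \<noteq> {}" if "t \<subseteq> T" "card t = DIM(real^2) + 1" for t
        using small [of t] that T by (auto intro: finite_subset)
    qed
  qed
  obtain p0 where p0: "p0 \<in> K" using K(2) by blast
  have "nball p0 \<rho> \<inter> \<Inter>?F \<noteq> {}"
  proof (rule compact_imp_fip)
    show "compact (nball p0 \<rho>)" by (rule compact_nball)
    show "closed T" if "T \<in> ?F" for T using that compact_nball compact_imp_closed by blast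
    show "nball p0 \<rho> \<inter> \<Inter>F' \<noteq> {}" if "finite F'" "F' \<subseteq> ?F" for F'
      using fin [of "insert (nball p0 \<rho>) F'"] that p0 by simp
  qed
  then obtain x where "\<And>p. p \<in> K \<Longrightarrow> x \<in> nball p \<rho>" by blast
  then have "K \<subseteq> nball x \<rho>" by (auto simp: nball_def N_commute)
  then show False using circumradius_le [OF \<rho>(1), of K x] \<rho>(2) by linarith
qed

text \<open>The Helly argument needs a radius strictly below the circumradius; nested compact sets
  of triples carry it to the limit.\<close>

lemma critical_triple_exists:
  assumes K: "compact K" "K \<noteq> {}" and R: "circumradius N K = 1"
  shows "critical_triples K 1 \<noteq> {}"
proof -
  \<comment> \<open>With \<open>Suc n\<close> the radii are nonnegative, starting from 0.\<close>
  define F where "F n = critical_triples K (1 - 1 / real (Suc n))" for n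
  have "\<Inter> (range F) \<noteq> {}"
  proof (rule compact_nest)
    show "compact (F n)" for n unfolding F_def by (rule compact_critical_triples [OF K(1)])
    show "F n \<noteq> {}" for n unfolding F_def by (rule critical_triples_nonempty [OF K]) (auto simp: R)
    show "F n \<subseteq> F m" if "m \<le> n" for m n
    proof -
      have "1 / real (Suc n) \<le> 1 / real (Suc m)" using that by (simp add: frac_le)
      then have "1 - 1 / real (Suc m) \<le> 1 - 1 / real (Suc n)" by linarith
      then show ?thesis unfolding F_def critical_triples_def using order_trans by blast
    qed
  qed
  then obtain z where z: "\<And>n. z \<in> F n" by blast
  have "1 \<le> max (N (fst z - x)) (max (N (fst (snd z) - x)) (N (snd (snd z) - x)))" for x
  proof (rule field_le_epsilon)
    fix e :: real assume "0 < e"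
    then obtain n where "1 / real (Suc n) < e" by (metis nat_approx_posE)
    moreover have "1 - 1 / real (Suc n) \<le>
      max (N (fst z - x)) (max (N (fst (snd z) - x)) (N (snd (snd z) - x)))"
      using z [of n] unfolding F_def critical_triples_def by blast
    ultimately show "1 \<le> max (N (fst z - x)) (max (N (fst (snd z) - x)) (N (snd (snd z) - x))) + e"
      by linarith
  qed
  moreover have "z \<in> K \<times> K \<times> K" using z [of 0] unfolding F_def critical_triples_def by blast
  ultimately have "z \<in> critical_triples K 1" unfolding critical_triples_def by blast
  then show ?thesis by blast
qed

lemma body_contains_inscribed:
  assumes K: "compact K" "K \<noteq> {}" "K \<subseteq> nball 0 1" "circumradius N K = 1" and d: "norm_diameter N K < 2"
  obtains p q s where "p \<in> K" "q \<in> K" "s \<in> K" "inscribed (norm_diameter N K) p q s"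
proof -
  obtain p q s where "(p, q, s) \<in> critical_triples K 1"
    using critical_triple_exists [OF K(1,2,4)] by (metis ex_in_conv prod_cases3)
  then have pqs: "p \<in> K" "q \<in> K" "s \<in> K" "\<And>x. 1 \<le> N (p - x) \<or> 1 \<le> N (q - x) \<or> 1 \<le> N (s - x)"
    by (auto simp: mem_critical_triples)
  have "inscribed (norm_diameter N K) p q s"
    using pqs K d N_le_norm_diameter by (intro inscribedI) (auto simp: nball_def)
  then show thesis using that pqs by blast
qed

text \<open>In general \<open>d\<close> only bounds the diameter; an edge of length \<open>d\<close>
  makes the triangle a competitor for \<open>min_inradius N d\<close>.\<close>

lemma inscribed_triangle:
  assumes I: "inscribed d p q s" and d: "d < 2"
  defines "T \<equiv> convex hull {p, q, s}"
  shows "T \<in> convex_bodies" "circumradius N T = 1" "norm_diameter N T \<le> d"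
    "N (p - q) = d \<Longrightarrow> norm_diameter N T = d" "inradius N T = triangle_inradius p q s"
    "triangle_with_vertices T p q s"
proof -
  have n: "N p = 1" "N q = 1" "N s = 1" "N (p - q) \<le> d" "N (q - s) \<le> d" "N (s - p) \<le> d"
    using I by (auto simp: inscribed_def)
  have T: "compact T" "T \<noteq> {}" unfolding T_def by (auto simp: finite_imp_compact_convex_hull)
  then show "T \<in> convex_bodies" by (simp add: convex_bodies_def T_def)
  have mem: "p \<in> T" "q \<in> T" "s \<in> T" by (auto simp: T_def hull_inc)
  show "circumradius N T = 1"
  proof (rule antisym)
    have "T \<subseteq> nball 0 1" unfolding T_def using n
      by (intro hull_minimal convex_nball) (auto simp: nball_def)
    then show "circumradius N T \<le> 1" by (intro circumradius_le) auto
    show "1 \<le> circumradius N T"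
    proof (rule circumradius_ge [OF T])
      fix c r assume "T \<subseteq> nball c r"
      then have "N (p - c) \<le> r" "N (q - c) \<le> r" "N (s - c) \<le> r" using mem by (auto simp: nball_def)
      then show "1 \<le> r" using inscribed_circumradius_ge [OF I d, of c] by linarith
    qed
  qed
  have d0: "0 \<le> d" using n(4) N_nonneg [of "p - q"] by (rule order_trans [rotated])
  show D: "norm_diameter N T \<le> d"
    unfolding T_def
  proof (rule norm_diameter_hull_le)
    fix x y assume "x \<in> {p, q, s}" "y \<in> {p, q, s}"
    then show "N (x - y) \<le> d"
      using n d0 N_commute [of q p] N_commute [of s q] N_commute [of p s] by auto
  qed simp
  show "N (p - q) = d \<Longrightarrow> norm_diameter N T = d"
    using D N_le_norm_diameter [OF T(1) mem(1,2)] by simp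
  have nd: "det2 (q - p) (s - p) \<noteq> 0" using inscribed_nondegenerate [OF I d] .
  then show "inradius N T = triangle_inradius p q s" unfolding T_def by (rule inradius_triangle)
  show "triangle_with_vertices T p q s"
    unfolding triangle_with_vertices_def T_def using collinear_3_det2 nd by blast
qed

lemma normalized_body:
  assumes K: "K \<in> convex_bodies" and R: "0 < circumradius N K"
  obtains K' c where "K' \<in> convex_bodies" "K' \<subseteq> nball 0 1" "circumradius N K' = 1"
    "norm_diameter N K' = norm_diameter N K / circumradius N K"
    "inradius N K' = inradius N K / circumradius N K"
    "K = (\<lambda>x. c + circumradius N K *\<^sub>R x) ` K'"
proof -
  let ?R = "circumradius N K"
  have c: "compact K" "K \<noteq> {}" "convex K" using K by (auto simp: convex_bodies_def)
  obtain c where sub: "K \<subseteq> nball c ?R" using circumball_exists c by blast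
  define K' where "K' = (\<lambda>x. (- (1 / ?R) *\<^sub>R c) + (1 / ?R) *\<^sub>R x) ` K"
  have t: "0 < 1 / ?R" using R by simp
  show thesis
  proof (rule that [of K' c])
    have "compact K'" unfolding K'_def by (intro compact_continuous_image continuous_intros c)
    moreover have "convex K'" unfolding K'_def by (intro convex_affinity c)
    ultimately show "K' \<in> convex_bodies" using c by (simp add: convex_bodies_def K'_def)
    show "K' \<subseteq> nball 0 1" unfolding K'_def affine_image_nball(1) [OF t] using R sub by simp
    show "circumradius N K' = 1" "norm_diameter N K' = norm_diameter N K / ?R"
      "inradius N K' = inradius N K / ?R"
      unfolding K'_def affine_scaling [OF t c(1,2)] using R by simp_all
    show "K = (\<lambda>x. c + ?R *\<^sub>R x) ` K'"
      unfolding K'_def image_image using R by (simp add: scaleR_diff_right)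
  qed
qed

lemma circumradius_pos:
  assumes K: "compact K" "x \<in> K" "y \<in> K" "x \<noteq> y"
  shows "0 < norm_diameter N K" "0 < circumradius N K"
proof -
  have "0 < N (x - y)" using K N_nonneg [of "x - y"] N_eq_0 [of "x - y"] by (simp add: less_le del: N_nonneg)
  then show D: "0 < norm_diameter N K" using N_le_norm_diameter [OF K(1-3)] by linarith
  have "K \<noteq> {}" using K by blast
  then show "0 < circumradius N K" using norm_diameter_le_circumradius [OF K(1)] D by fastforce
qed

text \<open>The Jung constant is only a supremum here. Let \<open>m\<close> be the least possible
  longest edge of a critical triple in the unit ball. Every body has diameter at least
  \<open>m\<close> times its circumradius, so \<open>m\<close> is at most the reciprocal of the Jung
  constant, and a triple attaining \<open>m\<close> serves for \<open>D\<close>.\<close>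

lemma inscribed_exists:
  assumes D: "1 / jung_constant N \<le> D" "D < 2"
  shows "\<exists>p q s. inscribed D p q s"
proof -
  obtain u where u: "N u = 1" by (rule N_unit_exists)
  let ?e = "\<lambda>z :: (real^2) \<times> (real^2) \<times> (real^2). max (N (fst z - fst (snd z)))
    (max (N (fst (snd z) - snd (snd z))) (N (snd (snd z) - fst z)))"
  let ?S = "critical_triples (nball 0 1) 1"
  have uu: "u + u = 2 *\<^sub>R u" by (simp add: scaleR_2)
  \<comment> \<open>This degenerate triple makes the set nonempty and gives
    \<open>m \<le> 2\<close>, which settles normalized bodies whose diameter is not below 2.\<close>
  have mem: "(u, - u, u) \<in> ?S"
  proof -
    have "1 \<le> N (u - x) \<or> 1 \<le> N (- u - x)" for x
    proof -
      have "N (u - - u) \<le> N (u - x) + N (- u - x)"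
        using N_triangle_mid [of u "- u" x] N_commute [of x "- u"] by simp
      moreover have "u - - u = 2 *\<^sub>R u" by (simp add: scaleR_2)
      then have "N (u - - u) = 2" using u by (simp add: N_scale)
      ultimately show ?thesis by linarith
    qed
    then show ?thesis using u by (auto simp: mem_critical_triples nball_def)
  qed
  have "compact ?S" by (intro compact_critical_triples compact_nball)
  moreover have "continuous_on ?S ?e" by (intro continuous_intros)
  ultimately obtain z where z: "z \<in> ?S" "\<And>y. y \<in> ?S \<Longrightarrow> ?e z \<le> ?e y"
    using continuous_attains_inf [of ?S ?e] mem by blast
  obtain p q s where pqs: "z = (p, q, s)" by (cases z)
  define m where "m = ?e z"
  have e: "N (p - q) \<le> m" "N (q - s) \<le> m" "N (s - p) \<le> m" by (auto simp: m_def pqs)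
  have m0: "0 < m"
  proof (rule ccontr)
    assume "\<not> 0 < m"
    then have "N (p - q) = 0" "N (s - p) = 0" using e
      by (metis N_nonneg antisym not_le order_trans)+
    then have "p = q" "s = p" by auto
    then have "1 \<le> N (p - p)" using z(1) unfolding pqs mem_critical_triples by blast
    then show False by simp
  qed
  have "N (u + u) = 2" using u unfolding uu by (simp add: N_scale)
  moreover have "N (- u - u) = N (u + u)" using N_minus [of "u + u"] by simp
  ultimately have m2: "m \<le> 2" using z(2) [OF mem] unfolding m_def by simp
  have ratio: "circumradius N K / norm_diameter N K \<le> 1 / m" if K: "K \<in> convex_bodies" "\<not> (\<exists>x. K = {x})" for K
  proof -
    have c: "compact K" "K \<noteq> {}" using K by (auto simp: convex_bodies_def)
    obtain x y where xy: "x \<in> K" "y \<in> K" "x \<noteq> y" using K(2) c(2) by blast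
    note pos = circumradius_pos [OF c(1) xy]
    obtain K' where K': "K' \<in> convex_bodies" "K' \<subseteq> nball 0 1" "circumradius N K' = 1"
      "norm_diameter N K' = norm_diameter N K / circumradius N K"
      using normalized_body [OF K(1) pos(2)] by metis
    have "m \<le> norm_diameter N K'"
    proof (cases "norm_diameter N K' < 2")
      case True
      have "compact K'" "K' \<noteq> {}" using K'(1) by (auto simp: convex_bodies_def)
      then obtain p' q' s' where I: "inscribed (norm_diameter N K') p' q' s'"
        using body_contains_inscribed [OF _ _ K'(2,3) True] by blast
      then have "(p', q', s') \<in> ?S" "?e (p', q', s') \<le> norm_diameter N K'"
        using True by (auto simp: inscribed_iff_critical_triples)
      then show ?thesis using z(2) unfolding m_def by (meson order_trans)
    next
      case False
      then show ?thesis using m2 by linarith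
    qed
    then show ?thesis using m0 pos unfolding K'(4) by (simp add: field_simps)
  qed
  let ?J = "{circumradius N K / norm_diameter N K | K. K \<in> convex_bodies \<and> \<not> (\<exists>x. K = {x})}"
  \<comment> \<open>One nondegenerate body makes the set of ratios nonempty and its supremum
    positive, so the bound can be inverted.\<close>
  define K0 where "K0 = closed_segment 0 u"
  have u0: "u \<noteq> 0" using u by auto
  have "0 \<in> K0" "u \<in> K0" by (simp_all add: K0_def)
  then have "\<not> (\<exists>x. K0 = {x})" using u0 by (metis singletonD)
  moreover have "K0 \<in> convex_bodies" by (auto simp: K0_def convex_bodies_def)
  ultimately have K0: "K0 \<in> convex_bodies" "\<not> (\<exists>x. K0 = {x})" by blast+
  have pos: "0 < norm_diameter N K0" "0 < circumradius N K0"
    using circumradius_pos [of K0 0 u] u0 by (auto simp: K0_def)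
  have "circumradius N K0 / norm_diameter N K0 \<le> jung_constant N"
    unfolding jung_constant_def
  proof (rule cSup_upper)
    show "bdd_above ?J" using ratio by (intro bdd_aboveI [of _ "1 / m"]) blast
  qed (use K0 in blast)
  moreover have "0 < circumradius N K0 / norm_diameter N K0" using pos by simp
  ultimately have j0: "0 < jung_constant N" by linarith
  have "jung_constant N \<le> 1 / m"
    unfolding jung_constant_def using K0 ratio by (intro cSup_least) blast+
  then have "m \<le> 1 / jung_constant N" using j0 m0 by (simp add: field_simps)
  then have "m \<le> D" using D by linarith
  then have "inscribed D p q s"
    using e z(1) D(2) by (simp add: inscribed_iff_critical_triples pqs)
  then show ?thesis by blast
qed

subsection \<open>Strict growth of the inradius\<close>

text \<open>Adding a small multiple of the zero relation trades part of the weight at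
  \<open>q\<close> and \<open>s\<close> for extra weight at \<open>p\<close>. The multiple of
  \<open>p\<close> gets longer while the bound on the other side gets shorter.\<close>

lemma unit_vector_not_interior:
  assumes l: "0 < l1" "0 < l2" "0 < l3" "l1 *\<^sub>R p + l2 *\<^sub>R q + l3 *\<^sub>R s = 0"
    and n: "N p = 1" "N q \<le> 1" "N s \<le> 1" "N z \<le> 1"
    and ab: "0 < a" "0 < b" and z: "z + a *\<^sub>R q + b *\<^sub>R s = (1 + a + b) *\<^sub>R p"
  shows False
proof -
  \<comment> \<open>The largest multiple that keeps both remaining weights nonnegative.\<close>
  define t where "t = min (a / l2) (b / l3)"
  have t: "0 < t" "t * l2 \<le> a" "t * l3 \<le> b"
    unfolding t_def using l ab by (auto simp: min_def field_simps)
  have "(1 + a + b + t * l1) *\<^sub>R p = (1 + a + b) *\<^sub>R p + t *\<^sub>R (l1 *\<^sub>R p + l2 *\<^sub>R q + l3 *\<^sub>R s)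
      - (t * l2) *\<^sub>R q - (t * l3) *\<^sub>R s"
    by (simp add: algebra_simps)
  also have "\<dots> = 1 *\<^sub>R z + ((a - t * l2) *\<^sub>R q + (b - t * l3) *\<^sub>R s)"
    unfolding l(4) z [symmetric] by (simp add: algebra_simps)
  finally have "N ((1 + a + b + t * l1) *\<^sub>R p) \<le> N z + N ((a - t * l2) *\<^sub>R q + (b - t * l3) *\<^sub>R s)"
    using N_triangle by simp
  also have "\<dots> \<le> 1 + ((a - t * l2) * N q + (b - t * l3) * N s)"
    using N_combination2 [of "a - t * l2" q "b - t * l3" s] t n by (intro add_mono) auto
  also have "\<dots> \<le> 1 + ((a - t * l2) * 1 + (b - t * l3) * 1)"
    using t n by (intro add_mono mult_left_mono) auto
  finally have "N ((1 + a + b + t * l1) *\<^sub>R p) \<le> 1 + (a - t * l2 + (b - t * l3))" by simp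
  moreover have "0 < t * l1" "0 < t * l2" "0 < t * l3" using t l by simp_all
  moreover have "N ((1 + a + b + t * l1) *\<^sub>R p) = 1 + a + b + t * l1"
    using n ab t l by (simp add: N_scale)
  ultimately show False by linarith
qed

text \<open>Both \<open>- s\<close> and \<open>\<alpha> e + \<beta> f\<close> have
  \<open>e\<close>-coordinate \<open>\<alpha>\<close>, while \<open>q\<close> has the smaller value
  \<open>1 - \<alpha>\<close>. Scaled by the ratio \<open>\<sigma> < 1\<close>, the segment between
  the first two contains \<open>q\<close>, so \<open>N q < 1\<close>.\<close>

lemma vertex_on_supporting_edge:
  assumes q: "q = (1 - \<alpha>) *\<^sub>R e - l *\<^sub>R f" and s: "s = - (\<alpha> *\<^sub>R e) + (1 - l) *\<^sub>R f"
    and n: "N q = 1" "N s = 1" "N (\<alpha> *\<^sub>R e + \<beta> *\<^sub>R f) \<le> 1"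
    and \<alpha>: "1 / 2 < \<alpha>" and l: "0 \<le> l" "l \<le> 1 - \<alpha>" and \<beta>: "0 < \<beta>"
  shows False
proof -
  define \<sigma> where "\<sigma> = (1 - \<alpha>) / \<alpha>"
  have \<sigma>: "0 \<le> \<sigma>" "\<sigma> < 1" "\<alpha> * \<sigma> = 1 - \<alpha>" unfolding \<sigma>_def using \<alpha> l by (auto simp: field_simps)
  define k where "k = 1 - l + \<beta>"
  have k: "0 < k" unfolding k_def using \<alpha> \<beta> l by linarith
  \<comment> \<open>The solution of the two coordinate equations for \<open>q\<close> as a
    combination of \<open>- s\<close> and \<open>\<alpha> e + \<beta> f\<close>.\<close>
  define a b where "a = (\<sigma> * \<beta> + l) / k" and "b = (\<sigma> * (1 - l) - l) / k"
  have "a + b = \<sigma> * k / k" unfolding a_def b_def by (simp add: k_def algebra_simps flip: add_divide_distrib)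
  then have ab: "a + b = \<sigma>" using k by simp
  have a0: "0 \<le> a" unfolding a_def using \<sigma> \<beta> l k by simp
  have "\<sigma> * \<alpha> \<le> \<sigma> * (1 - l)" using \<sigma> l by (intro mult_left_mono) auto
  then have "l \<le> \<sigma> * (1 - l)" using \<sigma>(3) l by (simp add: mult.commute)
  then have b0: "0 \<le> b" unfolding b_def using k by simp
  have "b * \<beta> - a * (1 - l) = (- l * k) / k"
    unfolding a_def b_def by (simp add: k_def algebra_simps flip: diff_divide_distrib)
  then have f: "b * \<beta> - a * (1 - l) = - l" using k by simp
  have "a *\<^sub>R (- s) + b *\<^sub>R (\<alpha> *\<^sub>R e + \<beta> *\<^sub>R f) = (\<alpha> * (a + b)) *\<^sub>R e + (b * \<beta> - a * (1 - l)) *\<^sub>R f"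
    unfolding s by (simp add: algebra_simps)
  also have "\<dots> = q" unfolding ab f q \<sigma>(3) by (simp add: algebra_simps)
  finally have "N q \<le> \<bar>a\<bar> * N (- s) + \<bar>b\<bar> * N (\<alpha> *\<^sub>R e + \<beta> *\<^sub>R f)"
    using N_combination2 by metis
  also have "\<dots> \<le> a * 1 + b * 1" using a0 b0 n by (intro add_mono) (auto intro: mult_left_le)
  finally show False using n ab \<sigma> by simp
qed

text \<open>If the inball contained \<open>p\<close>, then the unit ball would lie in a parallelogram with sides
  parallel to the two edges at \<open>p\<close> and would contain two opposite vertices of it.\<close>
lemma inball_avoids_vertex:
  assumes I: "inscribed d p q s" and d: "d < 2" and r: "0 < r" and sub: "nball c r \<subseteq> convex hull {p, q, s}"
  shows "p \<notin> nball c r"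
proof
  assume p: "p \<in> nball c r"
  have n: "N p = 1" "N q = 1" "N s = 1" "N (p - q) < 2" "N (s - p) < 2"
    using I d by (auto simp: inscribed_def)
  obtain k1 k2 k3 where k: "0 < k1" "0 < k2" "0 < k3" "k1 *\<^sub>R p + k2 *\<^sub>R q + k3 *\<^sub>R s = 0"
    using inscribed_coefficients I d by blast
  let ?k = "k1 + k2 + k3"
  define l1 l2 l3 where "l1 = k1 / ?k" and "l2 = k2 / ?k" and "l3 = k3 / ?k"
  have l: "0 < l1" "0 < l2" "0 < l3" "l1 + l2 + l3 = 1"
    unfolding l1_def l2_def l3_def using k by (auto simp flip: add_divide_distrib)
  have "l1 *\<^sub>R p + l2 *\<^sub>R q + l3 *\<^sub>R s = (1 / ?k) *\<^sub>R (k1 *\<^sub>R p + k2 *\<^sub>R q + k3 *\<^sub>R s)"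
    unfolding l1_def l2_def l3_def by (simp add: scaleR_add_right)
  then have lz: "l1 *\<^sub>R p + l2 *\<^sub>R q + l3 *\<^sub>R s = 0" unfolding k(4) by simp
  define e f where "e = q - p" and "f = s - p"
  have nd: "det2 e f \<noteq> 0" unfolding e_def f_def by (rule inscribed_nondegenerate [OF I d])
  define X Y where "X v = det2 v f / det2 e f" and "Y v = det2 e v / det2 e f" for v
  have rep: "v = X v *\<^sub>R e + Y v *\<^sub>R f" for v
  proof -
    have "det2 e f *\<^sub>R v = det2 v f *\<^sub>R e + det2 e v *\<^sub>R f"
      by (simp add: vec_eq_iff forall_2 det2_def algebra_simps)
    then have "(1 / det2 e f) *\<^sub>R (det2 e f *\<^sub>R v) = (1 / det2 e f) *\<^sub>R (det2 v f *\<^sub>R e + det2 e v *\<^sub>R f)"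
      by simp
    then show ?thesis using nd by (simp add: X_def Y_def scaleR_add_right)
  qed
  have lin: "X (v + w) = X v + X w" "Y (v + w) = Y v + Y w" "X (t *\<^sub>R v) = t * X v" "Y (t *\<^sub>R v) = t * Y v"
    for v w t by (simp_all add: X_def Y_def det2_simps add_divide_distrib)
  have neg: "X (- v) = - X v" "Y (- v) = - Y v" for v by (simp_all add: X_def Y_def det2_simps)
  have XY: "X (p + a *\<^sub>R e + b *\<^sub>R f) = X p + a" "Y (p + a *\<^sub>R e + b *\<^sub>R f) = Y p + b" for a b
    unfolding lin using nd by (simp_all add: X_def Y_def det2_simps)
  have hull: "X p \<le> X y \<and> Y p \<le> Y y" if y: "y \<in> convex hull {p, q, s}" for y
  proof -
    obtain u v w where uvw: "0 \<le> v" "0 \<le> w" "u + v + w = 1" "y = u *\<^sub>R p + v *\<^sub>R q + w *\<^sub>R s"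
      using y unfolding convex_hull_3 by blast
    have u: "u = 1 - v - w" using uvw by simp
    have "y = p + v *\<^sub>R e + w *\<^sub>R f"
      unfolding uvw(4) e_def f_def u by (simp add: algebra_simps)
    then show ?thesis using XY uvw by simp
  qed
  \<comment> \<open>The point of the unit ball that corresponds to \<open>p\<close> in the inball.
    As \<open>p\<close> minimises both coordinates over the triangle, \<open>b\<close> minimises
    both over the unit ball; by symmetry the ball lies in the parallelogram with opposite corners
    \<open>b\<close> and \<open>- b\<close>.\<close>
  define b where "b = (1 / r) *\<^sub>R (p - c)"
  have pb: "p = c + r *\<^sub>R b" unfolding b_def using r by simp
  have nb: "N b \<le> 1" using p r by (simp add: b_def nball_def N_scale)
  define \<alpha> \<beta> where "\<alpha> = - X b" and "\<beta> = - Y b"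
  have low: "- \<alpha> \<le> X y \<and> - \<beta> \<le> Y y" if "N y \<le> 1" for y
  proof -
    have "c + r *\<^sub>R y \<in> nball c r" using that r by (simp add: nball_def N_scale mult_left_le)
    then have "X p \<le> X (c + r *\<^sub>R y) \<and> Y p \<le> Y (c + r *\<^sub>R y)" using hull sub by blast
    then show ?thesis unfolding pb lin \<alpha>_def \<beta>_def using r by simp
  qed
  have up: "X y \<le> \<alpha> * N y \<and> Y y \<le> \<beta> * N y" for y
  proof (cases "y = 0")
    case True
    then show ?thesis using lin(3,4) [of 0 0] by simp
  next
    case False
    then have y: "0 < N y" using N_nonneg [of y] N_eq_0 [of y] by linarith
    then have "N (- ((1 / N y) *\<^sub>R y)) \<le> 1" by (simp add: N_scale del: N_eq_0)
    from low [OF this] show ?thesis unfolding neg lin using y by (simp add: field_simps)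
  qed
  have "X e = 1" "Y f = 1" using nd by (simp_all add: X_def Y_def)
  then have ge1: "1 \<le> \<alpha> * N e" "1 \<le> \<beta> * N f" using up [of e] up [of f] by simp_all
  \<comment> \<open>Edges shorter than 2 force the half-widths \<open>\<alpha>\<close> and
    \<open>\<beta>\<close> of the parallelogram above 1/2.\<close>
  have e2: "N e < 2" "N f < 2" using n N_commute [of q p] by (simp_all add: e_def f_def)
  have half: "1 / 2 < t" if "1 \<le> t * m" "0 \<le> m" "m < 2" for t m :: real
  proof (rule ccontr)
    assume "\<not> 1 / 2 < t"
    then have "t * m \<le> 1 / 2 * m" using that by (intro mult_right_mono) auto
    then show False using that by linarith
  qed
  have \<alpha>\<beta>: "1 / 2 < \<alpha>" "1 / 2 < \<beta>"
    using half [OF ge1(1) _ e2(1)] half [OF ge1(2) _ e2(2)] by simp_all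
  have "p + l2 *\<^sub>R e + l3 *\<^sub>R f = (1 - l2 - l3) *\<^sub>R p + l2 *\<^sub>R q + l3 *\<^sub>R s"
    by (simp add: e_def f_def algebra_simps)
  also have "1 - l2 - l3 = l1" using l by simp
  finally have p0: "p + l2 *\<^sub>R e + l3 *\<^sub>R f = 0" unfolding lz .
  have Xp: "X p = - l2" "Y p = - l3"
    using XY [of l2 l3] lin(3,4) [of 0 0] unfolding p0 by simp_all
  have pe: "p = - (l2 *\<^sub>R e) - l3 *\<^sub>R f" using rep [of p] unfolding Xp by simp
  have qe: "q = (1 - l2) *\<^sub>R e - l3 *\<^sub>R f"
  proof -
    have "q = p + e" by (simp add: e_def)
    then show ?thesis unfolding pe by (simp add: algebra_simps)
  qed
  have se: "s = - (l2 *\<^sub>R e) + (1 - l3) *\<^sub>R f"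
  proof -
    have "s = p + f" by (simp add: f_def)
    then show ?thesis unfolding pe by (simp add: algebra_simps)
  qed
  have be: "b = - (\<alpha> *\<^sub>R e + \<beta> *\<^sub>R f)" using rep [of b] by (simp add: \<alpha>_def \<beta>_def add.commute)
  have nab: "N (\<alpha> *\<^sub>R e + \<beta> *\<^sub>R f) \<le> 1" using nb unfolding be N_minus .
  \<comment> \<open>If \<open>p\<close> is off both sides through the corner \<open>b\<close>, a
    multiple of it is \<open>b\<close> plus positive multiples of \<open>q\<close> and
    \<open>s\<close>; if \<open>p\<close> is on such a side, \<open>q\<close> or \<open>s\<close>
    would have norm below 1.\<close>
  have "l2 \<le> \<alpha>" "l3 \<le> \<beta>" using low [of p] n Xp by simp_all
  then consider "l2 < \<alpha>" "l3 < \<beta>" | "l2 = \<alpha>" | "l3 = \<beta>" by linarith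
  then show False
  proof cases
    case 1
    show False
    proof (rule unit_vector_not_interior [OF l(1-3) lz])
      show "b + (\<alpha> - l2) *\<^sub>R q + (\<beta> - l3) *\<^sub>R s = (1 + (\<alpha> - l2) + (\<beta> - l3)) *\<^sub>R p"
        unfolding be pe qe se by (simp add: algebra_simps)
    qed (use 1 n nb in auto)
  next
    case 2
    show False
      using vertex_on_supporting_edge [of q \<alpha> e l3 f s \<beta>] qe se nab n \<alpha>\<beta> l 2 by simp
  next
    case 3
    show False
    proof (rule vertex_on_supporting_edge [of s \<beta> f l2 e q \<alpha>])
      show "s = (1 - \<beta>) *\<^sub>R f - l2 *\<^sub>R e" using se 3 by (simp add: algebra_simps)
      show "q = - (\<beta> *\<^sub>R f) + (1 - l2) *\<^sub>R e" using qe 3 by (simp add: algebra_simps)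
      show "N (\<beta> *\<^sub>R f + \<alpha> *\<^sub>R e) \<le> 1" using nab by (simp add: add.commute)
    qed (use n \<alpha>\<beta> l 3 in auto)
  qed
qed

section \<open>Moving and enlarging the inball inside a larger body\<close>

lemma nball_enlarge:
  assumes "open U" "nball c r \<subseteq> U" "0 < r"
  obtains r' where "r < r'" "nball c r' \<subseteq> U"
proof -
  obtain m where m: "0 < m" "\<And>x. m * norm x \<le> N x" by (rule norm_le_N) blast
  obtain e where e: "0 < e" "(\<Union>x\<in>nball c r. ball x e) \<subseteq> U"
    using compact_subset_open_imp_ball_epsilon_subset [OF compact_nball assms(1,2)] by blast
  \<comment> \<open>\<open>N\<close>-distance at most \<open>\<delta>\<close> implies Euclidean
    distance below \<open>e\<close>.\<close>
  define \<delta> where "\<delta> = e * m / 2"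
  have \<delta>: "0 < \<delta>" "\<delta> < e * m" unfolding \<delta>_def using e m by simp_all
  have "y \<in> U" if y: "y \<in> nball c (r + \<delta>)" for y
  proof -
    define w where "w = c + (r / (r + \<delta>)) *\<^sub>R (y - c)"
    have N: "N (y - c) \<le> r + \<delta>" using y by (simp add: nball_def)
    have "N (w - c) = r / (r + \<delta>) * N (y - c)" using assms \<delta> by (simp add: w_def N_scale)
    also have "\<dots> \<le> r / (r + \<delta>) * (r + \<delta>)" using N assms \<delta> by (intro mult_left_mono) auto
    finally have w: "w \<in> nball c r" using assms \<delta> by (simp add: nball_def)
    have "y - w = (1 - r / (r + \<delta>)) *\<^sub>R (y - c)" by (simp add: w_def algebra_simps)
    also have "1 - r / (r + \<delta>) = \<delta> / (r + \<delta>)" using assms \<delta> by (simp add: field_simps)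
    finally have "N (y - w) = \<delta> / (r + \<delta>) * N (y - c)" using assms \<delta> by (simp add: N_scale)
    also have "\<dots> \<le> \<delta> / (r + \<delta>) * (r + \<delta>)" using N assms \<delta> by (intro mult_left_mono) auto
    finally have "N (y - w) \<le> \<delta>" using assms \<delta> by simp
    then have "m * norm (y - w) < e * m" using m(2) [of "y - w"] \<delta> by linarith
    then have "norm (y - w) < e" using m by (simp add: mult.commute)
    then have "y \<in> ball w e" by (simp add: dist_norm norm_minus_commute)
    then show ?thesis using e w by blast
  qed
  then show thesis using that [of "r + \<delta>"] \<delta> by (simp add: subset_iff)
qed

text \<open>Either the positive minimum of \<open>h\<close> absorbs a small change of any sign, or
  the change itself is positive.\<close>

lemma small_shift_positive:
  fixes h :: "'a :: topological_space \<Rightarrow> real"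
  assumes "compact C" "continuous_on C h" "(\<forall>z\<in>C. 0 < h z) \<or> 0 < k \<and> (\<forall>z\<in>C. 0 \<le> h z)"
  obtains \<epsilon>0 where "0 < \<epsilon>0" "\<And>\<epsilon> z. 0 < \<epsilon> \<Longrightarrow> \<epsilon> \<le> \<epsilon>0 \<Longrightarrow> z \<in> C \<Longrightarrow> 0 < h z + \<epsilon> * k"
  using assms(3)
proof
  assume pos: "\<forall>z\<in>C. 0 < h z"
  show thesis
  proof (cases "C = {}")
    case True
    then show thesis using that [of 1] by simp
  next
    case False
    then obtain z0 where z0: "z0 \<in> C" "\<And>z. z \<in> C \<Longrightarrow> h z0 \<le> h z"
      using continuous_attains_inf [OF assms(1) _ assms(2)] by blast
    show thesis
    proof (rule that [of "h z0 / (\<bar>k\<bar> + 1)"])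
      show "0 < h z0 / (\<bar>k\<bar> + 1)" using pos z0 by simp
      fix \<epsilon> z assume e: "0 < \<epsilon>" "\<epsilon> \<le> h z0 / (\<bar>k\<bar> + 1)" "z \<in> C"
      have "- (\<epsilon> * k) \<le> \<epsilon> * \<bar>k\<bar>" using e by (simp add: abs_if mult_less_0_iff not_less)
      also have "\<dots> < \<epsilon> * (\<bar>k\<bar> + 1)" using e by simp
      also have "\<dots> \<le> h z0" using e by (simp add: pos_le_divide_eq)
      finally show "0 < h z + \<epsilon> * k" using z0(2) [OF e(3)] by linarith
    qed
  qed
next
  assume A: "0 < k \<and> (\<forall>z\<in>C. 0 \<le> h z)"
  then show thesis by (intro that [of 1]) (auto intro: add_nonneg_pos)
qed

text \<open>The direction points from \<open>s\<close> to the midpoint of the opposite edge.\<close>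

lemma bary_shift:
  assumes "det2 (q - p) (s - p) \<noteq> 0"
  shows "bary p q s (z + t *\<^sub>R (p + q - 2 *\<^sub>R s)) = bary p q s z + t"
    and "bary q s p (z + t *\<^sub>R (p + q - 2 *\<^sub>R s)) = bary q s p z + t"
    and "bary s p q (z + t *\<^sub>R (p + q - 2 *\<^sub>R s)) = bary s p q z - 2 * t"
proof -
  let ?d = "det2 (q - p) (s - p)" and ?v = "t *\<^sub>R (p + q - 2 *\<^sub>R s)"
  have "det2 (s - q) ?v = t * ?d" "det2 (p - s) ?v = t * ?d" "det2 (q - p) ?v = (- 2 * t) * ?d"
    by (simp_all add: det2_def algebra_simps)
  with assms show "bary p q s (z + ?v) = bary p q s z + t" "bary q s p (z + ?v) = bary q s p z + t"
    "bary s p q (z + ?v) = bary s p q z - 2 * t"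
    unfolding bary_affine det2_cyclic by (simp_all del: minus_diff_eq)
qed

text \<open>Moving the inball away from \<open>s\<close> detaches it from the two edges at \<open>s\<close>, while the
  point \<open>x\<close> gives it room across the third edge, except at the vertices, which it avoids.\<close>
lemma inradius_strict_across_edge:
  assumes I: "inscribed d p q s" and d: "d < 2"
    and K: "compact K" "convex K" "p \<in> K" "q \<in> K" "s \<in> K" "x \<in> K"
    and x: "bary s p q x < 0" "0 \<le> bary p q s x" "0 \<le> bary q s p x"
  shows "triangle_inradius p q s < inradius N K"
proof -
  let ?r = "triangle_inradius p q s" and ?T = "convex hull {p, q, s}"
  have nd: "det2 (q - p) (s - p) \<noteq> 0" using inscribed_nondegenerate [OF I d] .
  have r: "0 < ?r" unfolding triangle_inradius_def using dual_norm_perimeter_pos [OF nd] nd by simp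
  obtain c where c: "nball c ?r \<subseteq> ?T" using inball_triangle [OF nd] by blast
  define C where "C = nball c ?r"
  have C: "compact C" unfolding C_def by (rule compact_nball)
  have pC: "p \<notin> C" unfolding C_def by (rule inball_avoids_vertex [OF I d r c])
  have "convex hull {q, s, p} = ?T" by (simp add: insert_commute)
  then have qC: "q \<notin> C" unfolding C_def
    using inball_avoids_vertex [OF inscribed_rotate [OF I] d] r c by metis
  define b1 b2 b3 where "b1 = bary p q s" and "b2 = bary q s p" and "b3 = bary s p q"
  have b0: "0 \<le> b1 z" "0 \<le> b2 z" "0 \<le> b3 z" if "z \<in> C" for z
    using that c mem_triangle_iff [OF nd, of z] by (auto simp: C_def b1_def b2_def b3_def)
  have rep: "z = b1 z *\<^sub>R p + b2 z *\<^sub>R q + b3 z *\<^sub>R s" for z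
    unfolding b1_def b2_def b3_def by (rule bary_repr [OF nd])
  have sum: "b1 z + b2 z + b3 z = 1" for z
    unfolding b1_def b2_def b3_def by (rule bary_sum [OF nd])
  have x': "b3 x < 0" "0 \<le> b1 x" "0 \<le> b2 x" using x by (simp_all add: b1_def b2_def b3_def)
  \<comment> \<open>When \<open>s\<close> is traded for \<open>x\<close>, a point \<open>w\<close>
    has weights \<open>b1 w - g1 * b3 w\<close> at \<open>p\<close> and
    \<open>b2 w - g2 * b3 w\<close> at \<open>q\<close>.\<close>
  define g1 g2 where "g1 = b1 x / b3 x" and "g2 = b2 x / b3 x"
  have g: "g1 \<le> 0" "g2 \<le> 0" unfolding g1_def g2_def using x' by (auto simp: divide_nonneg_neg)
  have edge: "0 < b1 z" "0 < b2 z" if z: "z \<in> C" "b3 z = 0" for z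
  proof -
    have "b1 z \<noteq> 0"
    proof
      assume "b1 z = 0"
      then have "b2 z = 1" using sum [of z] z by simp
      then have "z = q" using rep [of z] z \<open>b1 z = 0\<close> by simp
      then show False using z qC by simp
    qed
    moreover have "b2 z \<noteq> 0"
    proof
      assume "b2 z = 0"
      then have "b1 z = 1" using sum [of z] z by simp
      then have "z = p" using rep [of z] z \<open>b2 z = 0\<close> by simp
      then show False using z pC by simp
    qed
    ultimately show "0 < b1 z" "0 < b2 z" using b0 [OF z(1)] by auto
  qed
  have cont: "continuous_on A b1" "continuous_on A b2" "continuous_on A b3" for A
    unfolding b1_def b2_def b3_def by (intro continuous_intros)+
  have shift: "\<exists>\<epsilon>0>0. \<forall>\<epsilon> z. 0 < \<epsilon> \<longrightarrow> \<epsilon> \<le> \<epsilon>0 \<longrightarrow> z \<in> C \<longrightarrow> 0 < (b z - g * b3 z) + \<epsilon> * (1 + 2 * g)"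
    if b: "\<And>z. z \<in> C \<Longrightarrow> 0 \<le> b z" "\<And>z. z \<in> C \<Longrightarrow> b3 z = 0 \<Longrightarrow> 0 < b z" "continuous_on C b" and g: "g \<le> 0"
    for b g
  proof -
    \<comment> \<open>The shift changes \<open>b - g * b3\<close> by
      \<open>\<epsilon> * (1 + 2 * g)\<close>, possibly a loss. For \<open>g < 0\<close> the
      function is already positive on \<open>C\<close>, on the edge because \<open>p\<close> and
      \<open>q\<close> are avoided; for \<open>g = 0\<close> the change is a gain.\<close>
    have pos: "(\<forall>z\<in>C. 0 < b z - g * b3 z) \<or> 0 < 1 + 2 * g \<and> (\<forall>z\<in>C. 0 \<le> b z - g * b3 z)"
    proof (cases "g = 0")
      case True
      then show ?thesis using b by simp
    next
      case False
      then have g: "g < 0" using g by simp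
      have "0 < b z - g * b3 z" if z: "z \<in> C" for z
      proof (cases "b3 z = 0")
        case True
        then show ?thesis using b(2) [OF z] by simp
      next
        case False
        then have "g * b3 z < 0" using b0(3) [OF z] g by (simp add: mult_less_0_iff)
        then show ?thesis using b(1) [OF z] by linarith
      qed
      then show ?thesis by blast
    qed
    have "continuous_on C (\<lambda>z. b z - g * b3 z)" by (intro continuous_intros b cont)
    then obtain \<epsilon>0 where "0 < \<epsilon>0"
      "\<And>\<epsilon> z. 0 < \<epsilon> \<Longrightarrow> \<epsilon> \<le> \<epsilon>0 \<Longrightarrow> z \<in> C \<Longrightarrow> 0 < (b z - g * b3 z) + \<epsilon> * (1 + 2 * g)"
      using small_shift_positive [OF C _ pos] by blast
    then show ?thesis by blast
  qed
  obtain \<epsilon>1 where e1: "0 < \<epsilon>1"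
    "\<And>\<epsilon> z. 0 < \<epsilon> \<Longrightarrow> \<epsilon> \<le> \<epsilon>1 \<Longrightarrow> z \<in> C \<Longrightarrow> 0 < (b1 z - g1 * b3 z) + \<epsilon> * (1 + 2 * g1)"
    using shift [of b1 g1] b0 edge cont g by blast
  obtain \<epsilon>2 where e2: "0 < \<epsilon>2"
    "\<And>\<epsilon> z. 0 < \<epsilon> \<Longrightarrow> \<epsilon> \<le> \<epsilon>2 \<Longrightarrow> z \<in> C \<Longrightarrow> 0 < (b2 z - g2 * b3 z) + \<epsilon> * (1 + 2 * g2)"
    using shift [of b2 g2] b0 edge cont g by blast
  define \<epsilon> where "\<epsilon> = min \<epsilon>1 \<epsilon>2"
  have \<epsilon>: "0 < \<epsilon>" "\<epsilon> \<le> \<epsilon>1" "\<epsilon> \<le> \<epsilon>2" unfolding \<epsilon>_def using e1 e2 by auto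
  \<comment> \<open>An open set covered by the triangles \<open>p, q, s\<close> and
    \<open>x, p, q\<close>.\<close>
  define U where "U = {w. 0 < b1 w} \<inter> {w. 0 < b2 w} \<inter> {w. 0 < b1 w - g1 * b3 w} \<inter> {w. 0 < b2 w - g2 * b3 w}"
  have "open U" unfolding U_def by (intro open_Int open_Collect_less continuous_intros cont)
  have hull: "convex hull A \<subseteq> K" if "A \<subseteq> K" for A using that K(2) by (rule hull_minimal)
  have "U \<subseteq> K"
  proof
    fix w assume w: "w \<in> U"
    show "w \<in> K"
    proof (cases "0 \<le> b3 w")
      case True
      then have "w \<in> ?T" using w unfolding mem_triangle_iff [OF nd]
        by (auto simp: U_def b1_def b2_def b3_def)
      then show ?thesis using hull [of "{p, q, s}"] K by blast
    next
      case False
      define t where "t = b3 w / b3 x"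
      have t: "0 \<le> t" unfolding t_def using False x' by (simp add: zero_le_divide_iff)
      have tx: "t * b3 x = b3 w" "t * b1 x = g1 * b3 w" "t * b2 x = g2 * b3 w"
        unfolding t_def g1_def g2_def using x' by simp_all
      have "w = b1 w *\<^sub>R p + b2 w *\<^sub>R q + b3 w *\<^sub>R s" by (rule rep)
      also have "\<dots> = t *\<^sub>R (b1 x *\<^sub>R p + b2 x *\<^sub>R q + b3 x *\<^sub>R s)
          + (b1 w - t * b1 x) *\<^sub>R p + (b2 w - t * b2 x) *\<^sub>R q + (b3 w - t * b3 x) *\<^sub>R s"
        by (simp add: algebra_simps)
      also have "\<dots> = t *\<^sub>R x + (b1 w - t * b1 x) *\<^sub>R p + (b2 w - t * b2 x) *\<^sub>R q"
        unfolding rep [of x, symmetric] tx(1) by simp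
      finally have wx: "w = t *\<^sub>R x + (b1 w - t * b1 x) *\<^sub>R p + (b2 w - t * b2 x) *\<^sub>R q" .
      have "b3 x = 1 - b1 x - b2 x" using sum [of x] by simp
      then have "t * (1 - b1 x - b2 x) = b3 w" using tx(1) by simp
      then have one: "t + (b1 w - t * b1 x) + (b2 w - t * b2 x) = 1"
        using sum [of w] by (simp add: algebra_simps)
      have "0 \<le> b1 w - t * b1 x" "0 \<le> b2 w - t * b2 x"
        unfolding tx using w by (simp_all add: U_def)
      then have "w \<in> convex hull {x, p, q}"
        unfolding convex_hull_3 using t one wx by blast
      then show ?thesis using hull [of "{x, p, q}"] K by blast
    qed
  qed
  let ?v = "\<epsilon> *\<^sub>R (p + q - 2 *\<^sub>R s)"
  have "nball (c + ?v) ?r \<subseteq> U"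
  proof
    fix y assume "y \<in> nball (c + ?v) ?r"
    then have z: "y - ?v \<in> C" by (simp add: C_def nball_def algebra_simps)
    have "y = (y - ?v) + ?v" by simp
    then have b: "b1 y = b1 (y - ?v) + \<epsilon>" "b2 y = b2 (y - ?v) + \<epsilon>" "b3 y = b3 (y - ?v) - 2 * \<epsilon>"
      unfolding b1_def b2_def b3_def using bary_shift [OF nd, of "y - ?v" \<epsilon>] by simp_all
    show "y \<in> U"
      using e1(2) [OF \<epsilon>(1,2) z] e2(2) [OF \<epsilon>(1,3) z] b0 [OF z] \<epsilon>(1)
      unfolding U_def by (simp add: b algebra_simps)
  qed
  then obtain r' where r': "?r < r'" "nball (c + ?v) r' \<subseteq> U"
    using nball_enlarge \<open>open U\<close> r by blast
  then have "nball (c + ?v) r' \<subseteq> K" using \<open>U \<subseteq> K\<close> by blast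
  then have "r' \<le> inradius N K" using r r' by (intro inradius_ge [OF K(1)]) auto
  then show ?thesis using r' by linarith
qed

text \<open>Such an \<open>x\<close> lies beyond the vertex \<open>p\<close>, which makes
  \<open>p\<close> a convex combination of \<open>x\<close>, \<open>q\<close>, \<open>s\<close> with
  positive weights.\<close>

lemma two_negative_impossible:
  assumes I: "inscribed d p q s" and d: "d < 2" and x: "N x \<le> 1"
    and neg: "bary q s p x < 0" "bary s p q x < 0"
  shows False
proof -
  have n: "N p = 1" "N q = 1" "N s = 1" using I by (auto simp: inscribed_def)
  have nd: "det2 (q - p) (s - p) \<noteq> 0" using inscribed_nondegenerate [OF I d] .
  obtain a b c where abc: "0 < a" "0 < b" "0 < c" "a *\<^sub>R p + b *\<^sub>R q + c *\<^sub>R s = 0"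
    using inscribed_coefficients I d by blast
  show False
  proof (rule unit_vector_not_interior [OF abc])
    let ?b = "- bary q s p x" and ?c = "- bary s p q x"
    have "bary p q s x = 1 + ?b + ?c" using bary_sum [OF nd, of x] by simp
    moreover have "x + ?b *\<^sub>R q + ?c *\<^sub>R s = bary p q s x *\<^sub>R p"
      using arg_cong [OF bary_repr [OF nd, of x], of "\<lambda>y. y + ?b *\<^sub>R q + ?c *\<^sub>R s"] by simp
    ultimately show "x + ?b *\<^sub>R q + ?c *\<^sub>R s = (1 + ?b + ?c) *\<^sub>R p" by metis
  qed (use n x neg in auto)
qed

lemma inradius_strict:
  assumes I: "inscribed d p q s" and d: "d < 2"
    and K: "compact K" "convex K" "p \<in> K" "q \<in> K" "s \<in> K" "K \<subseteq> nball 0 1"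
    and ne: "K \<noteq> convex hull {p, q, s}"
  shows "triangle_inradius p q s < inradius N K"
proof -
  have nd: "det2 (q - p) (s - p) \<noteq> 0" using inscribed_nondegenerate [OF I d] .
  note I2 = inscribed_rotate [OF I] and I3 = inscribed_rotate [OF inscribed_rotate [OF I]]
  have "convex hull {p, q, s} \<subseteq> K" using K by (intro hull_minimal) auto
  then obtain x where x: "x \<in> K" "x \<notin> convex hull {p, q, s}" using ne by blast
  then have nx: "N x \<le> 1" using K by (auto simp: nball_def)
  have no: "\<not> (bary q s p x < 0 \<and> bary s p q x < 0)" "\<not> (bary s p q x < 0 \<and> bary p q s x < 0)"
    "\<not> (bary p q s x < 0 \<and> bary q s p x < 0)"
    using two_negative_impossible [OF I d nx] two_negative_impossible [OF I2 d nx]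
      two_negative_impossible [OF I3 d nx] by blast+
  have "bary p q s x < 0 \<or> bary q s p x < 0 \<or> bary s p q x < 0"
    using x(2) unfolding mem_triangle_iff [OF nd] by linarith
  then consider "bary s p q x < 0" "0 \<le> bary p q s x" "0 \<le> bary q s p x"
    | "bary p q s x < 0" "0 \<le> bary q s p x" "0 \<le> bary s p q x"
    | "bary q s p x < 0" "0 \<le> bary s p q x" "0 \<le> bary p q s x"
    using no by linarith
  then show ?thesis
  proof cases
    case 1
    then show ?thesis using inradius_strict_across_edge [OF I d K(1-5) x(1)] by blast
  next
    case 2
    then show ?thesis using inradius_strict_across_edge [OF I2 d K(1,2,4,5,3) x(1)] triangle_inradius_rotate by metis
  next
    case 3
    then show ?thesis using inradius_strict_across_edge [OF I3 d K(1,2,5,3,4) x(1)] triangle_inradius_rotate by metis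
  qed
qed

subsection \<open>Leftmost points\<close>

text \<open>Every competitor contains an inscribed triangle with edges at most \<open>D\<close>, so
  the relaxed minimum is a lower bound; the improved minimiser has diameter exactly \<open>D\<close>
  and attains it.\<close>

lemma min_inradius_attained:
  assumes D: "1 / jung_constant N \<le> D" "D < 2"
  obtains p q s where "inscribed D p q s" "min_inradius N D = triangle_inradius p q s"
    "N (p - q) = D" "N (s - p) = D \<or> N (q - s) = D"
    "\<And>p' q' s'. inscribed D p' q' s' \<Longrightarrow> triangle_inradius p q s \<le> triangle_inradius p' q' s'"
proof -
  obtain p0 q0 s0 where "inscribed D p0 q0 s0" using inscribed_exists [OF D] by blast
  then obtain p1 q1 s1 where 1: "inscribed D p1 q1 s1"
    "\<And>p' q' s'. inscribed D p' q' s' \<Longrightarrow> triangle_inradius p1 q1 s1 \<le> triangle_inradius p' q' s'"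
    using inscribed_minimizer D(2) by blast
  obtain p q s where 2: "inscribed D p q s" "triangle_inradius p q s \<le> triangle_inradius p1 q1 s1"
    "N (p - q) = D" "N (s - p) = D \<or> N (q - s) = D"
    using improve_isosceles [OF 1(1) D(2)] by blast
  have least: "triangle_inradius p q s \<le> triangle_inradius p' q' s'" if "inscribed D p' q' s'" for p' q' s'
    using 1(2) [OF that] 2(2) by linarith
  note T = inscribed_triangle [OF 2(1) D(2)]
  have "min_inradius N D = triangle_inradius p q s"
    unfolding min_inradius_def
  proof (rule cInf_eq_minimum)
    show "triangle_inradius p q s \<in> {inradius N K | K. K \<in> convex_bodies \<and> circumradius N K = 1 \<and> norm_diameter N K = D}"
      using T 2(3) by (auto intro!: exI [of _ "convex hull {p, q, s}"])
  next
    fix r assume "r \<in> {inradius N K | K. K \<in> convex_bodies \<and> circumradius N K = 1 \<and> norm_diameter N K = D}"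
    then obtain K where K: "r = inradius N K" "K \<in> convex_bodies" "circumradius N K = 1" "norm_diameter N K = D"
      by blast
    obtain K' where K': "K' \<in> convex_bodies" "K' \<subseteq> nball 0 1" "circumradius N K' = 1"
      "norm_diameter N K' = D" "inradius N K' = r"
      using normalized_body [OF K(2)] K by auto
    then have c: "compact K'" "convex K'" "K' \<noteq> {}" by (auto simp: convex_bodies_def)
    obtain a b c where abc: "a \<in> K'" "b \<in> K'" "c \<in> K'" "inscribed D a b c"
      using body_contains_inscribed [OF c(1,3) K'(2,3)] K'(4) D(2) by auto
    have "convex hull {a, b, c} \<subseteq> K'" using abc c by (intro hull_minimal) auto
    then have "inradius N (convex hull {a, b, c}) \<le> r"
      unfolding K'(5) [symmetric] using c by (intro inradius_mono) auto
    then show "triangle_inradius p q s \<le> r" using inscribed_triangle(5) [OF abc(4) D(2)] least [OF abc(4)] by linarith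
  qed
  then show thesis using that 2 least by blast
qed

lemma inradius_eq_0_imp_segment:
  assumes K: "K \<in> convex_bodies" "0 < circumradius N K" "inradius N K = 0"
  shows "is_segment K"
proof -
  have c: "compact K" "convex K" "K \<noteq> {}" using K by (auto simp: convex_bodies_def)
  obtain C where C: "0 < C" "\<And>x. N x \<le> C * norm x" by (rule N_le_norm) blast
  obtain m where m: "0 < m" "\<And>x. m * norm x \<le> N x" by (rule norm_le_N) blast
  have "interior K = {}"
  proof (rule ccontr)
    assume "interior K \<noteq> {}"
    then obtain y e where e: "0 < e" "ball y e \<subseteq> K" by (meson all_not_in_conv mem_interior)
    have "nball y (m * e / 2) \<subseteq> ball y e"
    proof
      fix x assume "x \<in> nball y (m * e / 2)"
      then have "m * norm (x - y) \<le> m * (e / 2)" using m(2) [of "x - y"] by (simp add: nball_def)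
      then have "norm (x - y) \<le> e / 2" using m(1) by simp
      then show "x \<in> ball y e" using e(1) by (simp add: dist_norm norm_minus_commute)
    qed
    then have "m * e / 2 \<le> inradius N K" using e m by (intro inradius_ge [OF c(1)]) auto
    moreover have "0 < m * e / 2" using e m by simp
    ultimately show False using K by linarith
  qed
  then have "affine hull K \<noteq> UNIV"
    using rel_interior_interior [of K] rel_interior_eq_empty [OF c(2)] c(3) by blast
  then have "aff_dim K \<noteq> DIM(real^2)" by (simp only: aff_dim_eq_full) simp
  moreover have "aff_dim K \<le> DIM(real^2)" by (rule aff_dim_le_DIM)
  ultimately have "aff_dim K \<le> 1" by simp
  then have "collinear K" by (simp add: collinear_aff_dim)
  then obtain a b where ab: "K = closed_segment a b"
    using compact_convex_collinear_segment c by metis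
  \<comment> \<open>The positive circumradius excludes a single point.\<close>
  have "a \<noteq> b"
  proof
    assume "a = b"
    then have "circumradius N K \<le> 0" using ab by (intro circumradius_le [of 0 K a]) auto
    then show False using K by simp
  qed
  then show ?thesis using ab unfolding is_segment_def by blast
qed

lemma unit_segment:
  assumes u: "N u = 1"
  defines "K \<equiv> closed_segment (- u) u"
  shows "K \<in> convex_bodies" "circumradius N K = 1" "norm_diameter N K = 2" "inradius N K = 0" "is_segment K"
proof -
  have u0: "u \<noteq> 0" using u by auto
  have c: "compact K" "K \<noteq> {}" by (auto simp: K_def)
  show "K \<in> convex_bodies" using c by (simp add: convex_bodies_def K_def)
  have "K \<subseteq> nball 0 1" unfolding K_def using u
    by (intro closed_segment_subset convex_nball) (auto simp: nball_def)
  then have R: "circumradius N K \<le> 1" by (intro circumradius_le) auto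
  have "N (u - - u) \<le> norm_diameter N K" by (intro N_le_norm_diameter c) (auto simp: K_def)
  moreover have "u - - u = 2 *\<^sub>R u" by (simp add: scaleR_2)
  ultimately have "2 \<le> norm_diameter N K" using u by (simp add: N_scale)
  \<comment> \<open>Half the diameter bounds the circumradius from below, so diameter 2 forces both
    values.\<close>
  then show "circumradius N K = 1" "norm_diameter N K = 2"
    using R norm_diameter_le_circumradius [OF c] by linarith+
  show "inradius N K = 0"
  proof (rule antisym)
    show "0 \<le> inradius N K" by (rule inradius_nonneg [OF c])
    show "inradius N K \<le> 0"
    proof (rule inradius_le [OF c(2)], rule ccontr)
      fix a r assume r: "nball a r \<subseteq> K" "\<not> r \<le> 0"
      obtain C where C: "0 < C" "\<And>x. N x \<le> C * norm x" by (rule N_le_norm) blast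
      have "ball a (r / C) \<subseteq> nball a r"
      proof
        fix x assume "x \<in> ball a (r / C)"
        then have "C * norm (x - a) < r" using C(1) by (simp add: dist_norm norm_minus_commute field_simps)
        then show "x \<in> nball a r" using C(2) [of "x - a"] by (simp add: nball_def)
      qed
      then have "ball a (r / C) \<subseteq> K" using r by blast
      then have "a \<in> interior K" using r C by (auto simp: mem_interior intro!: exI [of _ "r / C"])
      moreover have "interior K = {}" unfolding K_def by (simp add: interior_closed_segment_ge2)
      ultimately show False by blast
    qed
  qed
  have "- u \<noteq> u" using u0 by (simp add: vec_eq_iff)
  then show "is_segment K" unfolding is_segment_def K_def by blast
qed

lemma min_inradius_2: "min_inradius N 2 = 0"
proof -
  obtain u where u: "N u = 1" by (rule N_unit_exists)
  show ?thesis
    unfolding min_inradius_def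
  proof (rule cInf_eq_minimum)
    show "0 \<in> {inradius N K | K. K \<in> convex_bodies \<and> circumradius N K = 1 \<and> norm_diameter N K = 2}"
      using unit_segment [OF u] by (auto intro!: exI [of _ "closed_segment (- u) u"])
  next
    fix r assume "r \<in> {inradius N K | K. K \<in> convex_bodies \<and> circumradius N K = 1 \<and> norm_diameter N K = 2}"
    then show "0 \<le> r" using inradius_nonneg unfolding convex_bodies_def by blast
  qed
qed

lemma leftmost_body:
  assumes D: "1 / jung_constant N \<le> D" "D \<le> 2" and K: "mapped_to N K (min_inradius N D, D / 2)"
  shows "is_segment K \<or> is_triangle K"
proof -
  let ?R = "circumradius N K"
  have R: "K \<in> convex_bodies" "0 < ?R" "min_inradius N D = inradius N K / ?R" "D = norm_diameter N K / ?R"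
    using K by (auto simp: mapped_to_def field_simps)
  show ?thesis
  proof (cases "D = 2")
    case True
    then have "inradius N K = 0" using R min_inradius_2 by simp
    then show ?thesis using inradius_eq_0_imp_segment R by blast
  next
    case False
    then have D2: "D < 2" using D by simp
    obtain K' c where K': "K' \<in> convex_bodies" "K' \<subseteq> nball 0 1" "circumradius N K' = 1"
      "norm_diameter N K' = D" "inradius N K' = min_inradius N D" "K = (\<lambda>x. c + ?R *\<^sub>R x) ` K'"
      using normalized_body [OF R(1,2)] R(3,4) by metis
    then have cc: "compact K'" "convex K'" "K' \<noteq> {}" by (auto simp: convex_bodies_def)
    obtain p q s where pqs: "p \<in> K'" "q \<in> K'" "s \<in> K'" "inscribed D p q s"
      using body_contains_inscribed [OF cc(1,3) K'(2,3)] K'(4) D2 by auto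
    \<comment> \<open>By minimality; since any larger body in the unit ball would have strictly
      larger inradius, \<open>K'\<close> is the triangle of this triple.\<close>
    have "inradius N K' \<le> triangle_inradius p q s"
      using min_inradius_attained [OF D(1) D2] pqs(4) K'(5) by metis
    then have T: "K' = convex hull {p, q, s}"
      using inradius_strict [OF pqs(4) D2 cc(1,2) pqs(1-3) K'(2)] by force
    let ?f = "\<lambda>x. c + ?R *\<^sub>R x"
    have "K = convex hull {?f p, ?f q, ?f s}"
      using K'(6) convex_hull_affinity [of c ?R "{p, q, s}"] unfolding T by simp
    moreover have "\<not> collinear {?f p, ?f q, ?f s}"
    proof
      assume "collinear {?f p, ?f q, ?f s}"
      then have "det2 (?f q - ?f p) (?f s - ?f p) = 0" by (rule collinear_3_det2)
      moreover have "?f q - ?f p = ?R *\<^sub>R (q - p)" "?f s - ?f p = ?R *\<^sub>R (s - p)"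
        by (simp_all add: scaleR_diff_right)
      ultimately have "det2 (q - p) (s - p) = 0" using R(2) by (simp add: det2_simps(5,6))
      then show False using inscribed_nondegenerate [OF pqs(4) D2] by simp
    qed
    ultimately show ?thesis unfolding is_triangle_def triangle_with_vertices_def by blast
  qed
qed

lemma leftmost_isosceles:
  assumes D: "1 / jung_constant N \<le> D" "D \<le> 2"
  shows "\<exists>K. mapped_to N K (min_inradius N D, D / 2) \<and> (is_segment K \<or> is_isosceles_triangle N K)"
proof (cases "D = 2")
  case True
  obtain u where u: "N u = 1" by (rule N_unit_exists)
  show ?thesis
    using unit_segment [OF u] True min_inradius_2 by (auto simp: mapped_to_def)
next
  case False
  then have D2: "D < 2" using D by simp
  obtain p q s where I: "inscribed D p q s" and r: "min_inradius N D = triangle_inradius p q s"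
    and e: "N (p - q) = D" "N (s - p) = D \<or> N (q - s) = D"
    using min_inradius_attained [OF D(1) D2] by metis
  note T = inscribed_triangle [OF I D2]
  have "is_isosceles_triangle N (convex hull {p, q, s})"
    unfolding is_isosceles_triangle_def Let_def using T(4,6) e by blast
  then show ?thesis using T e r by (auto simp: mapped_to_def)
qed

end

theorem theorem5p5:
  fixes N :: "real^2 \<Rightarrow> real"
  assumes "is_norm N"
  shows "(\<forall>p \<in> leftmost_points N. \<forall>K. mapped_to N K p \<longrightarrow> is_segment K \<or> is_triangle K) \<and>
         (\<forall>p \<in> leftmost_points N. \<exists>K. mapped_to N K p \<and> (is_segment K \<or> is_isosceles_triangle N K))"
proof -
  interpret normed_plane N by (rule normed_plane.intro [OF assms])
  show ?thesis
  proof (intro conjI ballI allI impI)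
    fix p K assume "p \<in> leftmost_points N" "mapped_to N K p"
    then show "is_segment K \<or> is_triangle K" using leftmost_body by (auto simp: leftmost_points_def)
  next
    fix p assume "p \<in> leftmost_points N"
    then obtain D where D: "1 / jung_constant N \<le> D" "D \<le> 2" "p = (min_inradius N D, D / 2)"
      by (auto simp: leftmost_points_def)
    show "\<exists>K. mapped_to N K p \<and> (is_segment K \<or> is_isosceles_triangle N K)"
      unfolding D(3) by (rule leftmost_isosceles [OF D(1,2)])
  qed
qed

end
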